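(* Let $\mathcal{H}_A,\mathcal{H}_B$ be finite-dimensional complex Hilbert spaces, $d_A=\dim\mathcal{H}_A$, let $\rho_{AB}$ be a density operator on $\mathcal{H}_A\otimes\mathcal{H}_B$, and let $\tau_A=\mathrm{id}_A/d_A$ be the completely mixed state on $\mathcal{H}_A$. Then $$H_{\max}(A|B)_\rho=\log_2 q_{\mathsf{decpl}}(A|B)_\rho ,$$ where $$q_{\mathsf{decpl}}(A|B)_\rho:=d_A\max_{\sigma_B}F(\rho_{AB},\tau_A\otimes\sigma_B)^2,$$ with the maximum taken over all (normalized) density operators $\sigma_B$ on $\mathcal{H}_B$.
   Context: A density operator is a nonnegative (positive semidefinite) operator of trace one; $\mathrm{id}_A$ denotes the identity operator on $\mathcal{H}_A$. The fidelity is $F(\rho,\sigma)=\|\sqrt{\rho}\sqrt{\sigma}\|_1$ (trace norm). For nonnegative operators $\tau,\tau'$ define $D_\infty(\tau\|\tau'):=\inf\{\lambda\in\mathbb{R}:\ \tau\le 2^\lambda\tau'\}$, where $\le$ is the order on Hermitian operators and $\inf\emptyset=+\infty$. For a density operator $\rho_{AC}$ on $\mathcal{H}_A\otimes\mathcal{H}_C$, the conditional min-entropy is $$H_{\min}(A|C)_\rho:=-\inf_{\sigma_C}D_\infty(\rho_{AC}\|\mathrm{id}_A\otimes\sigma_C),$$ where the infimum ranges over all density operators $\sigma_C$ on $\mathcal{H}_C$. The conditional max-entropy of $\rho_{AB}$ is $$H_{\max}(A|B)_\rho:=-H_{\min}(A|C)_\rho ,$$ where the right-hand side is evaluated for the reduced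 state $\rho_{AC}=\mathrm{tr}_B\,\rho_{ABC}$ of a purification $\rho_{ABC}$ of $\rho_{AB}$, i.e. a rank-one density operator on $\mathcal{H}_A\otimes\mathcal{H}_B\otimes\mathcal{H}_C$ (for some finite-dimensional $\mathcal{H}_C$) with $\mathrm{tr}_C\,\rho_{ABC}=\rho_{AB}$; the value does not depend on the choice of purification. *)

theory Defs
  imports
    "HOL-Library.Extended_Real"
    "Jordan_Normal_Form.Schur_Decomposition"
    "Jordan_Normal_Form.DL_Rank"
begin

text \<open>
  A finite-dimensional Hilbert space of dimension \<open>d\<close> is the space \<open>carrier_vec d\<close> of complex
  vectors, so operators are complex \<open>d \<times> d\<close> matrices.  Dimensions are natural numbers rather than
  types, because the max-entropy refers to a purifying system of arbitrary dimension.
\<close>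

definition mat_trace :: "complex mat \<Rightarrow> complex" where
  "mat_trace A = (\<Sum>i<dim_row A. A $$ (i, i))"

text \<open>
  On complex numbers, \<open>0 \<le> z\<close> means that \<open>z\<close> is real and nonnegative; hermiticity is therefore
  implied in the next definition.
\<close>

definition psd :: "nat \<Rightarrow> complex mat \<Rightarrow> bool" where
  "psd n A \<longleftrightarrow> A \<in> carrier_mat n n \<and> (\<forall>v\<in>carrier_vec n. 0 \<le> (A *\<^sub>v v) \<bullet>c v)"

definition density :: "nat \<Rightarrow> complex mat \<Rightarrow> bool" where
  "density n \<rho> \<longleftrightarrow> psd n \<rho> \<and> mat_trace \<rho> = 1"

definition psd_sqrt :: "complex mat \<Rightarrow> complex mat" where
  "psd_sqrt A = (THE B. psd (dim_row A) B \<and> B * B = A)"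

definition trace_norm :: "complex mat \<Rightarrow> real" where
  "trace_norm X = Re (mat_trace (psd_sqrt (mat_adjoint X * X)))"

definition fidelity :: "complex mat \<Rightarrow> complex mat \<Rightarrow> real" where
  "fidelity \<rho> \<sigma> = trace_norm (psd_sqrt \<rho> * psd_sqrt \<sigma>)"

text \<open>
  In a tensor product of spaces of dimensions \<open>dX\<close> and \<open>dY\<close>, the basis vector \<open>e\<^sub>x \<otimes> e\<^sub>y\<close> has
  index \<open>x * dY + y\<close>.  With this convention the tensor product is strictly associative.
\<close>

definition tensor :: "complex mat \<Rightarrow> complex mat \<Rightarrow> complex mat" (infixl \<open>\<Otimes>\<close> 70) where
  "A \<Otimes> B = mat (dim_row A * dim_row B) (dim_col A * dim_col B)
     (\<lambda>(i, j). A $$ (i div dim_row B, j div dim_col B) * B $$ (i mod dim_row B, j mod dim_col B))"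

text \<open>Partial trace over the second factor of \<open>X \<otimes> Y\<close>.\<close>

definition ptrace_last :: "nat \<Rightarrow> nat \<Rightarrow> complex mat \<Rightarrow> complex mat" where
  "ptrace_last dX dY \<omega> = mat dX dX (\<lambda>(i, j). \<Sum>y<dY. \<omega> $$ (i * dY + y, j * dY + y))"

text \<open>Partial trace over the middle factor of \<open>X \<otimes> Y \<otimes> Z\<close>.\<close>

definition ptrace_middle :: "nat \<Rightarrow> nat \<Rightarrow> nat \<Rightarrow> complex mat \<Rightarrow> complex mat" where
  "ptrace_middle dX dY dZ \<omega> = mat (dX * dZ) (dX * dZ)
     (\<lambda>(i, j). \<Sum>y<dY. \<omega> $$ ((i div dZ * dY + y) * dZ + i mod dZ, (j div dZ * dY + y) * dZ + j mod dZ))"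

definition D_inf :: "nat \<Rightarrow> complex mat \<Rightarrow> complex mat \<Rightarrow> ereal" where
  "D_inf n \<tau> \<tau>' = Inf {ereal l | l. psd n (complex_of_real (2 powr l) \<cdot>\<^sub>m \<tau>' - \<tau>)}"

definition H_min :: "nat \<Rightarrow> nat \<Rightarrow> complex mat \<Rightarrow> ereal" where
  "H_min dA dC \<rho> = - (INF \<sigma>\<in>{\<sigma>. density dC \<sigma>}. D_inf (dA * dC) \<rho> (1\<^sub>m dA \<Otimes> \<sigma>))"

definition purification :: "nat \<Rightarrow> nat \<Rightarrow> complex mat \<Rightarrow> complex mat \<Rightarrow> bool" where
  "purification dX dC \<rho> \<omega> \<longleftrightarrow>
     density (dX * dC) \<omega> \<and> vec_space.rank (dX * dC) \<omega> = 1 \<and> ptrace_last dX dC \<omega> = \<rho>"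

text \<open>
  The definite description expresses that the value is the same for every purification, of any
  dimension \<open>dC\<close>.
\<close>

definition H_max :: "nat \<Rightarrow> nat \<Rightarrow> complex mat \<Rightarrow> ereal" where
  "H_max dA dB \<rho> = (THE h. \<exists>dC \<omega>. purification (dA * dB) dC \<rho> \<omega> \<and>
     h = - H_min dA dC (ptrace_middle dA dB dC \<omega>))"

definition mixed_state :: "nat \<Rightarrow> complex mat" where
  "mixed_state d = (1 / of_nat d) \<cdot>\<^sub>m 1\<^sub>m d"

text \<open>\<open>GREATEST\<close> rather than a supremum: the maximum has to be attained.\<close>

definition q_decpl :: "nat \<Rightarrow> nat \<Rightarrow> complex mat \<Rightarrow> real" where
  "q_decpl dA dB \<rho> =
     real dA * (GREATEST x. \<exists>\<sigma>. density dB \<sigma> \<and> x = (fidelity \<rho> (mixed_state dA \<Otimes> \<sigma>))\<^sup>2)"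

end

theory Submission
  imports Defs "HOL-Analysis.Function_Topology" "Jordan_Normal_Form.Spectral_Radius"
begin

text \<open>
  Let \<open>\<psi>\<close> be a purification, \<open>\<Psi>\<close> its amplitude matrix from \<open>C\<close> to \<open>A \<otimes> B\<close> and \<open>\<Phi>\<close> the one from
  \<open>B\<close> to \<open>A \<otimes> C\<close>, so that \<open>\<rho>\<^sub>A\<^sub>B = \<Psi> \<Psi>\<^sup>*\<close> and \<open>\<rho>\<^sub>A\<^sub>C = \<Phi> \<Phi>\<^sup>*\<close>.  The max-entropy is the logarithm of the
  least \<open>tr X\<close> with \<open>\<rho>\<^sub>A\<^sub>C \<le> 1 \<otimes> X\<close>.  By semidefinite duality this is the maximum of \<open>tr (\<rho>\<^sub>A\<^sub>C E)\<close>
  over \<open>E \<ge> 0\<close> with \<open>tr\<^sub>A E \<le> 1\<close>.  On the other side, \<open>d\<^sub>A F(\<rho>\<^sub>A\<^sub>B, \<tau>\<^sub>A \<otimes> \<sigma>)\<^sup>2\<close> is the square of the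
  trace norm of \<open>\<Psi>\<^sup>* (1 \<otimes> \<sigma>\<^bsup>1/2\<^esup>)\<close>, that is, of the maximum of \<open>tr (\<Psi>\<^sup>* (1 \<otimes> \<sigma>\<^bsup>1/2\<^esup>) W)\<close> over
  contractions \<open>W\<close>.  Moving indices, this trace is the pairing of \<open>\<sigma>\<^bsup>1/2\<^esup>\<close> (a vector of
  Hilbert-Schmidt norm one) with \<open>\<Phi>\<^sup>* Y\<close>, where \<open>Y\<close> is the reshuffled \<open>W\<close>; the contraction
  property of \<open>W\<close> becomes feasibility of \<open>E = Y Y\<^sup>*\<close>, and the squared Hilbert-Schmidt norm of
  \<open>\<Phi>\<^sup>* Y\<close> is \<open>tr (\<rho>\<^sub>A\<^sub>C E)\<close>.
\<close>

subsection \<open>Matrix algebra and positive semidefinite matrices\<close>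

lemma mat_adjoint_eq: "mat_adjoint A = mat (dim_col A) (dim_row A) (\<lambda>(i, j). cnj (A $$ (j, i)))"
  unfolding mat_adjoint_def by (rule eq_matI) (auto simp: mat_of_rows_index)

lemma dim_mat_adjoint [simp]:
  fixes A :: "complex mat"
  shows "dim_row (mat_adjoint A) = dim_col A" "dim_col (mat_adjoint A) = dim_row A"
  by (auto simp: mat_adjoint_eq)

lemma index_mat_adjoint [simp]:
  "i < dim_col A \<Longrightarrow> j < dim_row A \<Longrightarrow> mat_adjoint A $$ (i, j) = cnj (A $$ (j, i))"
  by (auto simp: mat_adjoint_eq)

lemma mat_adjoint_carrier [simp]:
  fixes A :: "complex mat"
  shows "A \<in> carrier_mat m n \<Longrightarrow> mat_adjoint A \<in> carrier_mat n m"
  by (metis carrier_matD carrier_matI dim_mat_adjoint)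

lemma mat_adjoint_adjoint [simp]: "mat_adjoint (mat_adjoint A) = (A :: complex mat)"
  by (rule eq_matI) auto

lemma mat_adjoint_add:
  fixes A B :: "complex mat"
  shows "dim_row A = dim_row B \<Longrightarrow> dim_col A = dim_col B \<Longrightarrow>
    mat_adjoint (A + B) = mat_adjoint A + mat_adjoint B"
  by (rule eq_matI) auto

lemma mat_adjoint_minus:
  fixes A B :: "complex mat"
  shows "dim_row A = dim_row B \<Longrightarrow> dim_col A = dim_col B \<Longrightarrow>
    mat_adjoint (A - B) = mat_adjoint A - mat_adjoint B"
  by (rule eq_matI) auto

lemma mat_adjoint_smult [simp]: "mat_adjoint (c \<cdot>\<^sub>m A) = cnj c \<cdot>\<^sub>m mat_adjoint A"
  by (rule eq_matI) auto

lemma mat_adjoint_one [simp]: "mat_adjoint (1\<^sub>m n) = (1\<^sub>m n :: complex mat)"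
  by (rule eq_matI) auto

lemma index_mult_mat_sum:
  "i < dim_row A \<Longrightarrow> j < dim_col B \<Longrightarrow> dim_col A = dim_row B \<Longrightarrow>
    (A * B) $$ (i, j) = (\<Sum>k<dim_row B. A $$ (i, k) * B $$ (k, j))"
  by (simp add: scalar_prod_def atLeast0LessThan)

lemma mat_adjoint_mult:
  fixes A B :: "complex mat"
  shows "dim_col A = dim_row B \<Longrightarrow> mat_adjoint (A * B) = mat_adjoint B * mat_adjoint A"
  by (rule eq_matI) (auto simp: index_mult_mat_sum mult.commute simp del: index_mult_mat(1))

lemmas mat_adjoint_simps = mat_adjoint_add mat_adjoint_minus mat_adjoint_mult

text \<open>The ring laws with premises on dimensions instead of carriers, so that the simplifier can
  discharge them.\<close>

lemma mat_mult_assoc: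
  fixes A B C :: "'a::semiring_0 mat"
  shows "dim_col A = dim_row B \<Longrightarrow> dim_col B = dim_row C \<Longrightarrow> A * B * C = A * (B * C)"
  by (rule assoc_mult_mat[of _ "dim_row A" "dim_col A" _ "dim_col B" _ "dim_col C"]) auto

lemma mat_add_mult:
  fixes A B C :: "'a::semiring_0 mat"
  shows "dim_row A = dim_row B \<Longrightarrow> dim_col A = dim_col B \<Longrightarrow> dim_col B = dim_row C \<Longrightarrow>
    (A + B) * C = A * C + B * C"
  by (rule add_mult_distrib_mat[of _ "dim_row A" "dim_col A" _ _ "dim_col C"]) auto

lemma mat_mult_add:
  fixes A B C :: "'a::semiring_0 mat"
  shows "dim_row C = dim_row B \<Longrightarrow> dim_col C = dim_col B \<Longrightarrow> dim_col A = dim_row B \<Longrightarrow>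
    A * (B + C) = A * B + A * C"
  by (rule mult_add_distrib_mat[of _ "dim_row A" "dim_col A" _ "dim_col B"]) auto

lemma mat_minus_mult:
  fixes A B C :: "'a::ring mat"
  shows "dim_row A = dim_row B \<Longrightarrow> dim_col A = dim_col B \<Longrightarrow> dim_col B = dim_row C \<Longrightarrow>
    (A - B) * C = A * C - B * C"
  by (rule minus_mult_distrib_mat[of _ "dim_row A" "dim_col A" _ _ "dim_col C"]) auto

lemma mat_mult_minus:
  fixes A B C :: "'a::ring mat"
  shows "dim_row C = dim_row B \<Longrightarrow> dim_col C = dim_col B \<Longrightarrow> dim_col A = dim_row B \<Longrightarrow>
    A * (B - C) = A * B - A * C"
  by (rule mult_minus_distrib_mat[of _ "dim_row A" "dim_col A" _ "dim_col B"]) auto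

lemma mat_smult_mult:
  fixes A B :: "'a::comm_semiring_0 mat"
  shows "dim_col A = dim_row B \<Longrightarrow> (c \<cdot>\<^sub>m A) * B = c \<cdot>\<^sub>m (A * B)"
  by (rule mult_smult_assoc_mat[of _ "dim_row A" "dim_col A" _ "dim_col B"]) auto

lemma mat_mult_smult:
  fixes A B :: "'a::comm_semiring_0 mat"
  shows "dim_col A = dim_row B \<Longrightarrow> A * (c \<cdot>\<^sub>m B) = c \<cdot>\<^sub>m (A * B)"
  by (rule mult_smult_distrib[of _ "dim_row A" "dim_col A" _ "dim_col B"]) auto

lemma mat_one_mult: "n = dim_row A \<Longrightarrow> 1\<^sub>m n * A = (A :: 'a::semiring_1 mat)"
  by simp

lemma mat_mult_one: "n = dim_col A \<Longrightarrow> A * 1\<^sub>m n = (A :: 'a::semiring_1 mat)"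
  by simp

lemma mat_smult_smult: "a \<cdot>\<^sub>m (b \<cdot>\<^sub>m A) = (a * b :: 'a::semigroup_mult) \<cdot>\<^sub>m A"
  by (rule eq_matI) (auto simp: mult.assoc)

lemmas mat_ring_simps = mat_mult_assoc mat_add_mult mat_mult_add mat_minus_mult mat_mult_minus
  mat_smult_mult mat_mult_smult mat_one_mult mat_mult_one mat_smult_smult

section \<open>Traces and the Hilbert-Schmidt norm\<close>

lemma mat_trace_add:
  "dim_row A = dim_row B \<Longrightarrow> dim_col A = dim_col B \<Longrightarrow> dim_row B = dim_col B \<Longrightarrow>
    mat_trace (A + B) = mat_trace A + mat_trace B"
  by (simp add: mat_trace_def sum.distrib)

lemma mat_trace_minus:
  "dim_row A = dim_row B \<Longrightarrow> dim_col A = dim_col B \<Longrightarrow> dim_row B = dim_col B \<Longrightarrow>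
    mat_trace (A - B) = mat_trace A - mat_trace B"
  by (simp add: mat_trace_def sum_subtractf)

lemma mat_trace_smult: "dim_row A = dim_col A \<Longrightarrow> mat_trace (c \<cdot>\<^sub>m A) = c * mat_trace A"
  by (simp add: mat_trace_def sum_distrib_left)

lemmas mat_trace_simps = mat_trace_add mat_trace_minus mat_trace_smult

lemma mat_trace_mult:
  "dim_row A = dim_col B \<Longrightarrow> dim_col A = dim_row B \<Longrightarrow>
    mat_trace (A * B) = (\<Sum>i<dim_row A. \<Sum>j<dim_row B. A $$ (i, j) * B $$ (j, i))"
  by (simp add: mat_trace_def index_mult_mat_sum del: index_mult_mat(1))

lemma mat_trace_comm:
  assumes "dim_row A = dim_col B" "dim_col A = dim_row B"
  shows "mat_trace (A * B) = mat_trace (B * A)"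
  using assms by (simp add: mat_trace_mult sum.swap[of _ "{..<dim_row B}"] mult.commute)

lemma mat_trace_adjoint: "dim_row A = dim_col A \<Longrightarrow> mat_trace (mat_adjoint A) = cnj (mat_trace A)"
  by (simp add: mat_trace_def)

lemma mat_trace_mult_adjoint:
  "mat_trace (mat_adjoint A * A) = (\<Sum>i<dim_row A. \<Sum>j<dim_col A. of_real ((cmod (A $$ (i, j)))\<^sup>2))"
proof -
  have "mat_trace (mat_adjoint A * A) = mat_trace (A * mat_adjoint A)"
    by (rule mat_trace_comm) auto
  then show ?thesis
    by (auto simp add: mat_trace_mult complex_norm_square simp del: of_real_power intro!: sum.cong)
qed

lemma mat_trace_mult_adjoint_nonneg: "0 \<le> mat_trace (mat_adjoint A * A)"
  unfolding mat_trace_mult_adjoint by (intro sum_nonneg) (auto simp: less_eq_complex_def)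

lemma mat_trace_mult_adjoint_eq_0:
  assumes "mat_trace (mat_adjoint A * A) = 0"
  shows "A = 0\<^sub>m (dim_row A) (dim_col A)"
proof -
  have "of_real (\<Sum>i<dim_row A. \<Sum>j<dim_col A. (cmod (A $$ (i, j)))\<^sup>2) = (0::complex)"
    using assms unfolding mat_trace_mult_adjoint by simp
  then have "(\<Sum>i<dim_row A. \<Sum>j<dim_col A. (cmod (A $$ (i, j)))\<^sup>2) = 0"
    by (simp only: of_real_eq_0_iff)
  then have "\<forall>i<dim_row A. \<forall>j<dim_col A. A $$ (i, j) = 0"
    by (simp add: sum_nonneg_eq_0_iff sum_nonneg)
  then show ?thesis by (intro eq_matI) auto
qed

section \<open>Quadratic forms and positivity\<close>

lemma quadratic_form_eq_sum:
  assumes "A \<in> carrier_mat n n" "v \<in> carrier_vec n"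
  shows "(A *\<^sub>v v) \<bullet>c v = (\<Sum>i<n. \<Sum>j<n. A $$ (i, j) * v $ j * cnj (v $ i))"
  using assms by (auto simp: scalar_prod_def atLeast0LessThan sum_distrib_right intro!: sum.cong)

text \<open>A Gram matrix is a sum of rank-one terms, one per column of \<open>Y\<close>. With a
  single column this expresses the quadratic form as a trace, so that later positivity proofs
  (through \<open>psdI\<close>) can work with cyclicity of the trace.\<close>

lemma mat_trace_mult_gram:
  assumes "A \<in> carrier_mat n n" "Y \<in> carrier_mat n m"
  shows "mat_trace (A * (Y * mat_adjoint Y)) = (\<Sum>k<m. (A *\<^sub>v col Y k) \<bullet>c col Y k)"
proof -
  have "mat_trace (A * (Y * mat_adjoint Y)) =
      (\<Sum>i<n. \<Sum>j<n. \<Sum>k<m. A $$ (i, j) * Y $$ (j, k) * cnj (Y $$ (i, k)))"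
    using assms by (simp add: mat_trace_mult index_mult_mat_sum sum_distrib_left mult.assoc
        del: index_mult_mat(1))
  also have "\<dots> = (\<Sum>k<m. \<Sum>i<n. \<Sum>j<n. A $$ (i, j) * Y $$ (j, k) * cnj (Y $$ (i, k)))"
    by (subst sum.swap, rule sum.cong[OF refl], subst (2) sum.swap) (rule refl)
  also have "\<dots> = (\<Sum>k<m. (A *\<^sub>v col Y k) \<bullet>c col Y k)"
    using assms by (intro sum.cong) (auto simp: quadratic_form_eq_sum[of _ n])
  finally show ?thesis .
qed

lemma psd_carrier: "psd n A \<Longrightarrow> A \<in> carrier_mat n n"
  by (simp add: psd_def)

lemma psd_dim: "psd n A \<Longrightarrow> dim_row A = n" "psd n A \<Longrightarrow> dim_col A = n"
  by (auto simp add: psd_def)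

lemma psd_trace_gram_nonneg:
  assumes "psd n A" "Y \<in> carrier_mat n m"
  shows "0 \<le> mat_trace (A * (Y * mat_adjoint Y))"
  using assms by (auto simp: mat_trace_mult_gram[OF psd_carrier] psd_def intro!: sum_nonneg)

lemma psdI:
  assumes "A \<in> carrier_mat n n"
    and "\<And>w. w \<in> carrier_mat n 1 \<Longrightarrow> 0 \<le> mat_trace (A * (w * mat_adjoint w))"
  shows "psd n A"
  unfolding psd_def
proof (intro conjI ballI assms)
  fix v :: "complex vec" assume v: "v \<in> carrier_vec n"
  define w where "w = mat n 1 (\<lambda>(i, j). v $ i)"
  have "col w 0 = v" using v by (intro eq_vecI) (auto simp: w_def)
  then show "0 \<le> (A *\<^sub>v v) \<bullet>c v"
    using assms(2)[of w] mat_trace_mult_gram[OF assms(1), of w 1] by (simp add: w_def)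
qed

lemma psd_gram:
  assumes "Y \<in> carrier_mat n m"
  shows "psd n (Y * mat_adjoint Y)"
proof (rule psdI)
  show "Y * mat_adjoint Y \<in> carrier_mat n n" using assms by auto
  fix w :: "complex mat" assume w: "w \<in> carrier_mat n 1"
  have d [simp]: "dim_row Y = n" "dim_col Y = m" "dim_row w = n" "dim_col w = 1"
    using assms w by auto
  have "mat_trace (Y * mat_adjoint Y * (w * mat_adjoint w)) =
      mat_trace (mat_adjoint (mat_adjoint Y * w) * (mat_adjoint Y * w))"
    using mat_trace_comm[of "mat_adjoint w" "Y * (mat_adjoint Y * w)"]
      mat_trace_comm[of "Y * (mat_adjoint Y * w)" "mat_adjoint w"]
    by (simp add: mat_ring_simps mat_adjoint_simps)
  then show "0 \<le> mat_trace (Y * mat_adjoint Y * (w * mat_adjoint w))"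
    using mat_trace_mult_adjoint_nonneg[of "mat_adjoint Y * w"] by simp
qed

lemma psd_add: "psd n A \<Longrightarrow> psd n B \<Longrightarrow> psd n (A + B)"
  unfolding psd_def by (auto simp: add_mult_distrib_mat_vec[of _ n n] add_scalar_prod_distrib[of _ n])

lemma psd_smult:
  assumes "psd n A" "0 \<le> c"
  shows "psd n (of_real c \<cdot>\<^sub>m A)"
proof (rule psdI)
  show "of_real c \<cdot>\<^sub>m A \<in> carrier_mat n n" using assms by (simp add: psd_def)
  fix w :: "complex mat" assume w: "w \<in> carrier_mat n 1"
  show "0 \<le> mat_trace (of_real c \<cdot>\<^sub>m A * (w * mat_adjoint w))"
    using psd_trace_gram_nonneg[OF assms(1) w] w assms
    by (simp add: psd_dim[OF assms(1)] mat_smult_mult mat_trace_smult less_eq_complex_def)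
qed

text \<open>Polarization: the quadratic form being real at the vectors e_i + z e_j for z = 1, -1, i,
  -i already forces hermiticity.\<close>

lemma psd_hermitian:
  assumes "psd n A"
  shows "mat_adjoint A = A"
proof (rule eq_matI)
  have A: "A \<in> carrier_mat n n" using assms by (rule psd_carrier)
  show "dim_row (mat_adjoint A) = dim_row A" "dim_col (mat_adjoint A) = dim_col A"
    using A by auto
  fix i j assume "i < dim_row A" "j < dim_col A"
  then have i: "i < n" and j: "j < n" using A by auto
  have form: "0 \<le> A $$ (i, i) + z * A $$ (i, j) + cnj z * A $$ (j, i) + z * cnj z * A $$ (j, j)" for z
  proof -
    define v where "v = vec n (\<lambda>k. of_bool (k = i) + z * of_bool (k = j))"
    have sift: "(\<Sum>l<n. f l * (of_bool (l = i) + y * of_bool (l = j))) = f i + y * f j" for f :: "nat \<Rightarrow> complex" and y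
    proof -
      have "{..<n} \<inter> {l. l = i} = {i}" "{..<n} \<inter> {l. l = j} = {j}" using i j by auto
      then have "(\<Sum>l<n. f l * of_bool (l = i)) = f i" "(\<Sum>l<n. f l * of_bool (l = j)) = f j"
        by simp_all
      then show ?thesis
        by (simp add: distrib_left sum.distrib mult.left_commute sum_distrib_left[symmetric]
            del: sum_mult_of_bool_eq)
    qed
    have "(A *\<^sub>v v) \<bullet>c v =
        (\<Sum>k<n. (\<Sum>l<n. A $$ (k, l) * (of_bool (l = i) + z * of_bool (l = j))) *
          (of_bool (k = i) + cnj z * of_bool (k = j)))"
      by (subst quadratic_form_eq_sum[OF A]) (auto simp: v_def sum_distrib_right intro!: sum.cong)
    also have "\<dots> = A $$ (i, i) + z * A $$ (i, j) + cnj z * A $$ (j, i) + z * cnj z * A $$ (j, j)"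
      by (simp only: sift) (simp add: algebra_simps)
    finally have eq: "(A *\<^sub>v v) \<bullet>c v =
      A $$ (i, i) + z * A $$ (i, j) + cnj z * A $$ (j, i) + z * cnj z * A $$ (j, j)" .
    have "0 \<le> (A *\<^sub>v v) \<bullet>c v" using assms by (auto simp: psd_def v_def)
    then show ?thesis using eq by simp
  qed
  have "A $$ (i, j) = cnj (A $$ (j, i))"
  proof -
    have im: "Im (A $$ (i, i) + z * A $$ (i, j) + cnj z * A $$ (j, i) + z * cnj z * A $$ (j, j)) = 0" for z
      using form[of z] by (simp only: less_eq_complex_def zero_complex.sel)
    \<comment> \<open>z = 1 and z = -1 differ by twice Im (a_ij + a_ji); z = i and z = -i differ by
      twice Re (a_ij - a_ji).\<close>
    show ?thesis
      using im[of 1] im[of "-1"] im[of \<i>] im[of "- \<i>"]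
      by (intro complex_eqI) simp_all
  qed
  then show "mat_adjoint A $$ (i, j) = A $$ (i, j)"
    using i j A by auto
qed

text \<open>Cyclicity and hermiticity make the trace equal to its own conjugate, so a real
  inequality suffices. The first-order condition in \<open>strong_duality\<close> delivers
  positivity in this form.\<close>

lemma psd_hermitianI:
  assumes "A \<in> carrier_mat n n" "mat_adjoint A = A"
    and "\<And>w. w \<in> carrier_mat n 1 \<Longrightarrow> 0 \<le> Re (mat_trace (A * (w * mat_adjoint w)))"
  shows "psd n A"
proof (rule psdI)
  show "A \<in> carrier_mat n n" by fact
  fix w :: "complex mat" assume w: "w \<in> carrier_mat n 1"
  have [simp]: "dim_row A = n" "dim_col A = n" "dim_row w = n" "dim_col w = 1" using assms w by auto
  have "cnj (mat_trace (A * (w * mat_adjoint w))) = mat_trace (mat_adjoint (A * (w * mat_adjoint w)))"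
    by (simp add: mat_trace_adjoint)
  also have "\<dots> = mat_trace (w * mat_adjoint w * A)"
    by (simp add: mat_adjoint_mult assms(2))
  also have "\<dots> = mat_trace (A * (w * mat_adjoint w))"
    by (rule mat_trace_comm) auto
  finally have "Im (mat_trace (A * (w * mat_adjoint w))) = 0"
    by (simp add: complex_eq_iff)
  then show "0 \<le> mat_trace (A * (w * mat_adjoint w))" using assms(3)[OF w] by (simp add: less_eq_complex_def)
qed

subsection \<open>Spectral theorem for Hermitian matrices\<close>

text \<open>Complete \<open>v\<close> to a basis, orthogonalize with Gram-Schmidt, which keeps the
  first vector, and normalize the columns; \<open>c\<close> is the reciprocal of the norm of
  \<open>v\<close>.\<close>

lemma exists_unitary_first_column:
  fixes v :: "complex vec"
  assumes v: "v \<in> carrier_vec n" and v0: "v \<noteq> 0\<^sub>v n"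
  obtains W c where "W \<in> carrier_mat n n" "mat_adjoint W * W = 1\<^sub>m n" "c \<noteq> 0" "col W 0 = c \<cdot>\<^sub>v v"
proof -
  interpret cof_vec_space n "TYPE(complex)" .
  have n: "0 < n" using v v0 by (cases n) auto
  define b where "b = basis_completion v"
  from basis_completion[OF v v0, folded b_def]
  have dist: "distinct b" and indep: "\<not> lin_dep (set b)" and b: "set b \<subseteq> carrier_vec n"
    and hd: "hd b = v" and len: "length b = n" by auto
  obtain vs where bv: "b = v # vs" using hd len n by (cases b) auto
  define ws where "ws = gram_schmidt n b"
  from gram_schmidt_result[OF b dist indep refl, folded ws_def]
  have ws: "set ws \<subseteq> carrier_vec n" "corthogonal ws" "length ws = n" by (auto simp: len)
  have "hd ws = v" unfolding ws_def bv by (rule gram_schmidt_hd[OF v])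
  then have ws0: "ws ! 0 = v" using ws n by (metis hd_conv_nth length_0_conv less_numeral_extra(3))
  define N where "N j = Re (ws ! j \<bullet>c ws ! j)" for j
  have carr: "ws ! j \<in> carrier_vec n" if "j < n" for j using ws that by auto
  have ortho: "ws ! i \<bullet>c ws ! j = (if i = j then of_real (N i) else 0)" if "i < n" "j < n" for i j
  proof (cases "i = j")
    case True
    have "0 \<le> ws ! i \<bullet>c ws ! i" by (rule conjugate_square_ge_0_vec)
    then show ?thesis using True by (simp add: N_def less_eq_complex_def complex_eq_iff)
  next
    case False
    then show ?thesis using ws that by (auto simp: corthogonal_def)
  qed
  have Npos: "0 < N i" if "i < n" for i
  proof -
    have "0 \<le> ws ! i \<bullet>c ws ! i" by (rule conjugate_square_ge_0_vec)
    moreover have "ws ! i \<bullet>c ws ! i \<noteq> 0" using ws that by (auto simp: corthogonal_def)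
    ultimately show ?thesis using ortho[OF that that]
      by (simp add: less_eq_complex_def)
  qed
  define W where "W = mat n n (\<lambda>(i, j). ws ! j $ i / of_real (sqrt (N j)))"
  have W: "W \<in> carrier_mat n n" by (simp add: W_def)
  have "mat_adjoint W * W = 1\<^sub>m n"
  proof (rule eq_matI)
    fix i j assume "i < dim_row (1\<^sub>m n :: complex mat)" "j < dim_col (1\<^sub>m n :: complex mat)"
    then have ij: "i < n" "j < n" by auto
    have "(mat_adjoint W * W) $$ (i, j) =
        (\<Sum>k<n. cnj (ws ! i $ k / of_real (sqrt (N i))) * (ws ! j $ k / of_real (sqrt (N j))))"
      using ij by (simp add: index_mult_mat_sum W_def del: index_mult_mat(1))
    also have "\<dots> = (\<Sum>k<n. ws ! j $ k * cnj (ws ! i $ k)) / of_real (sqrt (N i) * sqrt (N j))"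
      by (simp add: sum_divide_distrib mult.commute)
    also have "(\<Sum>k<n. ws ! j $ k * cnj (ws ! i $ k)) = ws ! j \<bullet>c ws ! i"
      using carr[OF ij(1)] carr[OF ij(2)] by (simp add: scalar_prod_def atLeast0LessThan)
    also have "\<dots> / of_real (sqrt (N i) * sqrt (N j)) = (if i = j then 1 else 0)"
      using Npos[OF ij(1)] ij by (auto simp: ortho simp flip: of_real_mult)
    finally show "(mat_adjoint W * W) $$ (i, j) = 1\<^sub>m n $$ (i, j)" using ij by simp
  qed (auto simp: W_def)
  moreover have "col W 0 = of_real (1 / sqrt (N 0)) \<cdot>\<^sub>v v"
    using n v by (intro eq_vecI) (auto simp: W_def ws0)
  moreover have "of_real (1 / sqrt (N 0)) \<noteq> (0 :: complex)" using Npos[OF n] by simp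
  ultimately show thesis using that W by blast
qed

definition real_diag :: "nat \<Rightarrow> (nat \<Rightarrow> real) \<Rightarrow> complex mat" where
  "real_diag n d = mat n n (\<lambda>(i, j). if i = j then of_real (d i) else 0)"

lemma dim_real_diag [simp]: "dim_row (real_diag n d) = n" "dim_col (real_diag n d) = n"
  by (simp_all add: real_diag_def)

lemma real_diag_adjoint [simp]: "mat_adjoint (real_diag n d) = real_diag n d"
  by (rule eq_matI) (auto simp: real_diag_def)

lemma real_diag_mult [simp]: "real_diag n d * real_diag n e = real_diag n (\<lambda>i. d i * e i)"
proof (rule eq_matI)
  fix i j assume "i < dim_row (real_diag n (\<lambda>i. d i * e i))" "j < dim_col (real_diag n (\<lambda>i. d i * e i))"
  then have "i < n" "j < n" by auto
  then show "(real_diag n d * real_diag n e) $$ (i, j) = real_diag n (\<lambda>i. d i * e i) $$ (i, j)"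
    by (simp add: index_mult_mat_sum real_diag_def if_distrib[of "\<lambda>x. x * _"] cong: if_cong
        del: index_mult_mat(1))
qed auto

text \<open>Induction on the dimension. A unitary \<open>W\<close> whose first column is an
  eigenvector turns \<open>A\<close> into \<open>B\<close>, whose first column is a multiple of the
  first unit vector; hermiticity clears the first row as well, and the induction hypothesis
  diagonalizes the remaining block \<open>C\<close>.\<close>

lemma hermitian_spectral:
  fixes A :: "complex mat"
  assumes "A \<in> carrier_mat n n" "mat_adjoint A = A"
  obtains U d where "U \<in> carrier_mat n n" "mat_adjoint U * U = 1\<^sub>m n" "A = U * real_diag n d * mat_adjoint U"
proof -
  have "\<exists>U d. U \<in> carrier_mat n n \<and> mat_adjoint U * U = 1\<^sub>m n \<and> A = U * real_diag n d * mat_adjoint U"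
    using assms
  proof (induction n arbitrary: A)
    case 0
    then show ?case by (intro exI[of _ A] exI[of _ "\<lambda>_. 0"] conjI) auto
  next
    case (Suc m A)
    let ?n = "Suc m"
    have dA [simp]: "dim_row A = ?n" "dim_col A = ?n" using Suc.prems by auto
    obtain e where "e \<in> spectrum A" using spectrum_non_empty[OF Suc.prems(1)] by auto
    then obtain v where v: "v \<in> carrier_vec ?n" "v \<noteq> 0\<^sub>v ?n" "A *\<^sub>v v = e \<cdot>\<^sub>v v"
      unfolding spectrum_def eigenvalue_def eigenvector_def by auto
    obtain W c where W: "W \<in> carrier_mat ?n ?n" "mat_adjoint W * W = 1\<^sub>m ?n"
      and c: "c \<noteq> 0" "col W 0 = c \<cdot>\<^sub>v v"
      using exists_unitary_first_column[OF v(1,2)] .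
    have dW [simp]: "dim_row W = ?n" "dim_col W = ?n" using W by auto
    have W': "W * mat_adjoint W = 1\<^sub>m ?n"
      using mat_mult_left_right_inverse[OF _ W(1) W(2)] W(1) by simp
    define B where "B = mat_adjoint W * A * W"
    have B: "B \<in> carrier_mat ?n ?n" using W Suc.prems by (auto simp: B_def)
    have dB [simp]: "dim_row B = ?n" "dim_col B = ?n" using B by auto
    have BH: "mat_adjoint B = B"
      using Suc.prems by (simp add: B_def mat_adjoint_simps mat_ring_simps)
    have "W * B = A * W"
      unfolding B_def using Suc.prems W'
      by (simp add: mat_mult_assoc[symmetric])
    have AB: "A = W * B * mat_adjoint W"
      unfolding \<open>W * B = A * W\<close> using W' by (simp add: mat_mult_assoc)
    have col0: "B $$ (i, 0) = (if i = 0 then e else 0)" if i: "i < ?n" for i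
    proof -
      have "(A * W) $$ (k, 0) = e * W $$ (k, 0)" if "k < ?n" for k
      proof -
        have "(A * W) $$ (k, 0) = (A *\<^sub>v col W 0) $ k" using that by simp
        also have "A *\<^sub>v col W 0 = e \<cdot>\<^sub>v col W 0"
          unfolding c using v Suc.prems by (simp add: mult_mat_vec[of A ?n ?n] smult_smult_assoc mult.commute)
        finally show ?thesis using that by simp
      qed
      then have "B $$ (i, 0) = (mat_adjoint W * (e \<cdot>\<^sub>m W)) $$ (i, 0)"
        using i by (simp add: B_def mat_mult_assoc index_mult_mat_sum del: index_mult_mat(1))
      also have "\<dots> = (e \<cdot>\<^sub>m 1\<^sub>m ?n) $$ (i, 0)" by (simp add: mat_mult_smult W)
      finally show ?thesis using i by simp
    qed
    have herm: "B $$ (i, j) = cnj (B $$ (j, i))" if "i < ?n" "j < ?n" for i j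
      using arg_cong[OF BH, of "\<lambda>M. M $$ (i, j)"] that by simp
    define C where "C = mat m m (\<lambda>(i, j). B $$ (Suc i, Suc j))"
    have C: "C \<in> carrier_mat m m" "mat_adjoint C = C"
    proof -
      show "C \<in> carrier_mat m m" by (simp add: C_def)
      show "mat_adjoint C = C" by (rule eq_matI) (simp_all add: C_def herm[symmetric])
    qed
    from Suc.IH[OF C] obtain V d where V: "V \<in> carrier_mat m m" "mat_adjoint V * V = 1\<^sub>m m"
      and CV: "C = V * real_diag m d * mat_adjoint V" by blast
    have dV [simp]: "dim_row V = m" "dim_col V = m" using V by auto
    \<comment> \<open>\<open>ext x M\<close> is block diagonal with blocks \<open>x\<close> and
      \<open>M\<close>. It respects products and adjoints, so the diagonalization of
      \<open>C\<close> lifts to one of \<open>B\<close>.\<close>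
    define ext where "ext x M = mat ?n ?n (\<lambda>(i, j). if i = 0 \<and> j = 0 then x
      else if i = 0 \<or> j = 0 then 0 else M $$ (i - 1, j - 1))" for x :: complex and M :: "complex mat"
    have d_ext [simp]: "dim_row (ext x M) = ?n" "dim_col (ext x M) = ?n" for x M by (auto simp: ext_def)
    have ext_mult: "ext x M * ext y N = ext (x * y) (M * N)"
      if "dim_row M = m" "dim_col M = m" "dim_row N = m" "dim_col N = m" for x y M N
    proof (rule eq_matI)
      fix i j assume "i < dim_row (ext (x * y) (M * N))" "j < dim_col (ext (x * y) (M * N))"
      then have "i < ?n" "j < ?n" by auto
      then show "(ext x M * ext y N) $$ (i, j) = ext (x * y) (M * N) $$ (i, j)"
        using that by (cases i; cases j)
          (simp_all add: ext_def index_mult_mat_sum sum.lessThan_Suc_shift del: index_mult_mat(1) sum.lessThan_Suc)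
    qed auto
    have ext_adj: "mat_adjoint (ext x M) = ext (cnj x) (mat_adjoint M)" if "dim_row M = m" "dim_col M = m" for x M
      using that by (intro eq_matI) (auto simp: ext_def)
    have ext_one: "ext 1 (1\<^sub>m m) = 1\<^sub>m ?n" by (rule eq_matI) (auto simp: ext_def)
    define d' where "d' i = (case i of 0 \<Rightarrow> Re e | Suc k \<Rightarrow> d k)" for i
    have e: "of_real (Re e) = e" using herm[of 0 0] col0[of 0] by (simp add: complex_eq_iff)
    have ext_diag: "ext e (real_diag m d) = real_diag ?n d'"
      by (rule eq_matI) (auto simp: ext_def real_diag_def d'_def e split: nat.splits)
    have Beq: "B = ext e C"
    proof (rule eq_matI)
      fix i j assume "i < dim_row (ext e C)" "j < dim_col (ext e C)"
      then have "i < ?n" "j < ?n" by auto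
      then show "B $$ (i, j) = ext e C $$ (i, j)"
        using col0[of i] col0[of j] herm[of 0 j] by (cases i; cases j) (auto simp: ext_def C_def)
    qed auto
    have "ext 1 V * real_diag ?n d' = ext e (V * real_diag m d)"
      unfolding ext_diag[symmetric] by (simp add: ext_mult)
    then have "ext 1 V * real_diag ?n d' * mat_adjoint (ext 1 V) = ext e (V * real_diag m d * mat_adjoint V)"
      by (simp add: ext_adj ext_mult)
    then have BV: "B = ext 1 V * real_diag ?n d' * mat_adjoint (ext 1 V)"
      unfolding Beq CV by simp
    have "mat_adjoint (ext 1 V) * ext 1 V = 1\<^sub>m ?n"
      by (simp add: ext_adj ext_mult V ext_one)
    then have "mat_adjoint (W * ext 1 V) * (W * ext 1 V) = 1\<^sub>m ?n"
      using W by (simp add: mat_adjoint_simps mat_mult_assoc)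
        (simp add: mat_mult_assoc[symmetric])
    moreover have "A = (W * ext 1 V) * real_diag ?n d' * mat_adjoint (W * ext 1 V)"
      unfolding AB BV by (simp add: mat_adjoint_simps mat_mult_assoc)
    moreover have "W * ext 1 V \<in> carrier_mat ?n ?n" by (rule carrier_matI) auto
    ultimately show ?case by blast
  qed
  then show thesis using that by blast
qed

subsection \<open>Square roots and contractions\<close>

lemma mat_minus_self: "n = dim_row A \<Longrightarrow> m = dim_col A \<Longrightarrow> A - A = (0\<^sub>m n m :: complex mat)"
  by (rule eq_matI) auto

lemma mat_minus_eq_0_imp_eq:
  fixes A B :: "complex mat"
  assumes "A - B = 0\<^sub>m n m" "dim_row A = n" "dim_row B = n" "dim_col A = m" "dim_col B = m"
  shows "A = B"
proof (rule eq_matI)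
  fix i j assume "i < dim_row B" "j < dim_col B"
  moreover from this have "(A - B) $$ (i, j) = 0" unfolding assms(1) using assms(3,5) by simp
  ultimately show "A $$ (i, j) = B $$ (i, j)" using assms(2-5) by simp
qed (use assms in auto)

lemma mat_adjoint_zero [simp]: "mat_adjoint (0\<^sub>m n m) = (0\<^sub>m m n :: complex mat)"
  by (rule eq_matI) auto

lemma unitary_swap:
  "U \<in> carrier_mat n n \<Longrightarrow> mat_adjoint U * U = 1\<^sub>m n \<Longrightarrow> U * mat_adjoint U = (1\<^sub>m n :: complex mat)"
  by (rule mat_mult_left_right_inverse[of _ n]) simp_all

lemma psd_congruence:
  assumes A: "psd n A" and Z: "Z \<in> carrier_mat m n"
  shows "psd m (Z * A * mat_adjoint Z)"
proof (rule psdI)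
  have [simp]: "dim_row A = n" "dim_col A = n" "dim_row Z = m" "dim_col Z = n"
    using A Z by (simp_all add: psd_dim)
  show "Z * A * mat_adjoint Z \<in> carrier_mat m m" by (rule carrier_matI) simp_all
  fix w :: "complex mat" assume w: "w \<in> carrier_mat m 1"
  then have [simp]: "dim_row w = m" "dim_col w = 1" by simp_all
  have "0 \<le> mat_trace (A * ((mat_adjoint Z * w) * mat_adjoint (mat_adjoint Z * w)))"
    by (rule psd_trace_gram_nonneg[OF A, of _ 1]) (rule carrier_matI; simp)
  also have "A * ((mat_adjoint Z * w) * mat_adjoint (mat_adjoint Z * w)) =
      A * (mat_adjoint Z * (w * mat_adjoint w)) * Z"
    by (simp add: mat_adjoint_simps mat_mult_assoc)
  also have "mat_trace \<dots> = mat_trace (Z * (A * (mat_adjoint Z * (w * mat_adjoint w))))"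
    by (rule mat_trace_comm) simp_all
  finally show "0 \<le> mat_trace (Z * A * mat_adjoint Z * (w * mat_adjoint w))"
    by (simp add: mat_mult_assoc)
qed

lemma psd_real_diag: "(\<And>i. 0 \<le> d i) \<Longrightarrow> psd n (real_diag n d)"
  using psd_gram[of "real_diag n (\<lambda>i. sqrt (d i))" n n] by (simp add: carrier_matI)

lemma psd_diagonal_nonneg:
  assumes "psd n A" "i < n"
  shows "0 \<le> A $$ (i, i)"
proof -
  have A: "A \<in> carrier_mat n n" using assms by (simp add: psd_carrier)
  have "A *\<^sub>v unit_vec n i = col A i" using A assms(2) by (intro eq_vecI) (simp_all add: scalar_prod_right_unit)
  moreover have "col A i \<bullet>c unit_vec n i = A $$ (i, i)"
    using A assms(2) by (simp add: scalar_prod_def sum.delta if_distrib[of "\<lambda>x. _ * x"] if_distrib[of cnj] unit_vec_def cong: if_cong)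
  moreover have "0 \<le> (A *\<^sub>v unit_vec n i) \<bullet>c unit_vec n i" using assms by (simp add: psd_def)
  ultimately show ?thesis by simp
qed

lemma psd_spectral:
  assumes "psd n A"
  obtains U d where "U \<in> carrier_mat n n" "mat_adjoint U * U = 1\<^sub>m n" "U * mat_adjoint U = 1\<^sub>m n"
    "A = U * real_diag n d * mat_adjoint U" "\<And>i. 0 \<le> d i"
proof -
  obtain U d where U: "U \<in> carrier_mat n n" "mat_adjoint U * U = 1\<^sub>m n"
    and A: "A = U * real_diag n d * mat_adjoint U"
    using hermitian_spectral[OF psd_carrier psd_hermitian, OF assms assms] .
  have [simp]: "dim_row U = n" "dim_col U = n" using U by simp_all
  have "mat_adjoint U * A * mat_adjoint (mat_adjoint U) = (mat_adjoint U * U) * real_diag n d * (mat_adjoint U * U)"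
    unfolding A by (simp add: mat_mult_assoc)
  also have "\<dots> = real_diag n d" by (simp add: U)
  finally have "psd n (real_diag n d)" using psd_congruence[OF assms, of "mat_adjoint U" n] U by simp
  then have nonneg: "0 \<le> d i" if "i < n" for i
    using psd_diagonal_nonneg[of n "real_diag n d" i] that by (simp add: real_diag_def less_eq_complex_def)
  \<comment> \<open>Values of \<open>d\<close> from \<open>n\<close> on do not enter the matrix, so
    truncating at zero makes nonnegativity hold at every index, without a range condition.\<close>
  have "real_diag n d = real_diag n (\<lambda>i. max 0 (d i))"
    by (rule eq_matI) (simp_all add: real_diag_def nonneg max_def)
  then show thesis using that[of U "\<lambda>i. max 0 (d i)"] U A unitary_swap[OF U] by simp
qed

lemma conj_real_diag_mult:
  assumes "U \<in> carrier_mat n n" "mat_adjoint U * U = 1\<^sub>m n"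
  shows "(U * real_diag n d * mat_adjoint U) * (U * real_diag n e * mat_adjoint U) =
    U * real_diag n (\<lambda>i. d i * e i) * mat_adjoint U"
proof -
  have [simp]: "dim_row U = n" "dim_col U = n" using assms by simp_all
  have "(U * real_diag n d * mat_adjoint U) * (U * real_diag n e * mat_adjoint U) =
    U * real_diag n d * (mat_adjoint U * U) * real_diag n e * mat_adjoint U"
    by (simp add: mat_mult_assoc)
  also have "\<dots> = U * (real_diag n d * real_diag n e) * mat_adjoint U"
    unfolding assms(2) by (simp add: mat_mult_assoc del: real_diag_mult)
  finally show ?thesis by simp
qed

lemma psd_sqrt_exists:
  assumes "psd n A"
  shows "\<exists>B. psd n B \<and> B * B = A"
proof -
  obtain U d where U: "U \<in> carrier_mat n n" "mat_adjoint U * U = 1\<^sub>m n"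
    and A: "A = U * real_diag n d * mat_adjoint U" and d: "\<And>i. 0 \<le> d i"
    using psd_spectral[OF assms] by metis
  let ?B = "U * real_diag n (\<lambda>i. sqrt (d i)) * mat_adjoint U"
  have "psd n ?B" using d by (intro psd_congruence[OF psd_real_diag U(1)]) simp
  moreover have "?B * ?B = A" unfolding A using d by (simp add: conj_real_diag_mult[OF U])
  ultimately show ?thesis by blast
qed

lemma psd_trace_mult_nonneg:
  assumes "psd n A" "psd n B"
  shows "0 \<le> mat_trace (A * B)"
proof -
  obtain C where C: "psd n C" "C * C = B" using psd_sqrt_exists[OF assms(2)] by blast
  then show ?thesis
    using psd_trace_gram_nonneg[OF assms(1) psd_carrier[OF C(1)]] by (simp add: psd_hermitian)
qed

text \<open>With \<open>C\<close> the square root of \<open>B\<close>, the trace is the squared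
  Hilbert-Schmidt norm of \<open>C * D\<close>; hence \<open>C * D\<close> vanishes, and with it B D
  = C C D.\<close>

lemma psd_mult_eq_0:
  assumes B: "psd n B" and D: "D \<in> carrier_mat n n" "mat_trace (mat_adjoint D * B * D) = 0"
  shows "B * D = 0\<^sub>m n n"
proof -
  obtain C where C: "psd n C" "C * C = B" using psd_sqrt_exists[OF B] by blast
  have [simp]: "dim_row C = n" "dim_col C = n" "dim_row D = n" "dim_col D = n"
    using C D by (simp_all add: psd_dim)
  have "mat_adjoint D * B * D = mat_adjoint (C * D) * (C * D)"
    using C by (simp add: mat_adjoint_simps psd_hermitian[OF C(1)] mat_mult_assoc C(2)[symmetric])
  then have "C * D = 0\<^sub>m n n" using mat_trace_mult_adjoint_eq_0[of "C * D"] D(2) by simp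
  moreover have "B * D = C * (C * D)" by (simp add: mat_mult_assoc C(2)[symmetric])
  ultimately show ?thesis by simp
qed

text \<open>For \<open>D = B - C\<close>, equality of the squares gives B D + D C = 0. Multiplying
  by \<open>D\<close> and taking the trace yields two nonnegative terms with sum zero, so
  \<open>psd_mult_eq_0\<close> gives B D = 0 and C D = 0, hence D D = 0.\<close>

lemma psd_sqrt_unique:
  assumes B: "psd n B" and C: "psd n C" and eq: "B * B = C * C"
  shows "B = C"
proof -
  have d [simp]: "dim_row B = n" "dim_col B = n" "dim_row C = n" "dim_col C = n"
    using B C by (simp_all add: psd_dim)
  define D where "D = B - C"
  have [simp]: "dim_row D = n" "dim_col D = n" by (simp_all add: D_def)
  have DH: "mat_adjoint D = D"
    by (simp add: D_def mat_adjoint_minus psd_hermitian[OF B] psd_hermitian[OF C])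
  have Dc: "D \<in> carrier_mat n n" by (rule carrier_matI) simp_all
  have "B * D + D * C = B * B - C * C"
    unfolding D_def by (rule eq_matI) (simp_all add: mat_ring_simps del: index_mult_mat(1))
  then have 0: "B * D + D * C = 0\<^sub>m n n" unfolding eq by (simp add: mat_minus_self)
  have "mat_trace (D * B * D) + mat_trace (D * C * D) = mat_trace (D * B * D) + mat_trace (D * (D * C))"
    using mat_trace_comm[of "D * C" D] by (simp add: mat_mult_assoc)
  also have "\<dots> = mat_trace (D * (B * D + D * C))"
    by (simp add: mat_mult_add mat_trace_add mat_mult_assoc)
  also have "\<dots> = 0" unfolding 0 by (simp add: mat_trace_def)
  finally have sum: "mat_trace (D * B * D) + mat_trace (D * C * D) = 0" .
  have nn: "0 \<le> mat_trace (D * X * D)" if "psd n X" for X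
  proof -
    have "0 \<le> mat_trace (X * (D * mat_adjoint D))" by (rule psd_trace_gram_nonneg[OF that Dc])
    also have "mat_trace (X * (D * mat_adjoint D)) = mat_trace (D * X * D)"
      using that mat_trace_comm[of "X * D" D] by (simp add: DH mat_mult_assoc psd_dim)
    finally show ?thesis .
  qed
  have "mat_trace (D * B * D) = 0" "mat_trace (D * C * D) = 0"
    using sum nn[OF B] nn[OF C] by (simp_all add: add_nonneg_eq_0_iff)
  then have "B * D = 0\<^sub>m n n" "C * D = 0\<^sub>m n n"
    using psd_mult_eq_0[OF B Dc] psd_mult_eq_0[OF C Dc] by (simp_all add: DH)
  then have "mat_adjoint D * D = 0\<^sub>m n n" unfolding DH
    by (subst D_def) (simp add: mat_minus_mult)
  then have "D = 0\<^sub>m n n" using mat_trace_mult_adjoint_eq_0[of D] by (simp add: mat_trace_def)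
  then show ?thesis unfolding D_def by (rule mat_minus_eq_0_imp_eq) simp_all
qed

lemma psd_sqrt_eqI: "psd n B \<Longrightarrow> B * B = A \<Longrightarrow> psd_sqrt A = B"
  unfolding psd_sqrt_def
  by (rule the_equality) (auto simp: psd_dim dest: psd_sqrt_unique)

lemma
  assumes "psd n A"
  shows psd_psd_sqrt: "psd n (psd_sqrt A)" and psd_sqrt_mult_self: "psd_sqrt A * psd_sqrt A = A"
  using psd_sqrt_exists[OF assms] psd_sqrt_eqI by metis+

lemma psd_pseudo_inverse:
  assumes "psd n R"
  obtains G where "G \<in> carrier_mat n n" "mat_adjoint G = G" "G * R = R * G" "G * R * R = R"
    "psd n (1\<^sub>m n - G * R)"
proof -
  obtain U d where U: "U \<in> carrier_mat n n" "mat_adjoint U * U = 1\<^sub>m n" "U * mat_adjoint U = 1\<^sub>m n"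
    and R: "R = U * real_diag n d * mat_adjoint U" and d: "\<And>i. 0 \<le> d i"
    using psd_spectral[OF assms] by metis
  have [simp]: "dim_row U = n" "dim_col U = n" using U by simp_all
  \<comment> \<open>As \<open>inverse 0 = 0\<close>, the kernel of \<open>R\<close> is sent to zero:
    \<open>G\<close> is the Moore-Penrose inverse and \<open>G * R\<close> the projection onto the
    range of \<open>R\<close>.\<close>
  define G where "G = U * real_diag n (\<lambda>i. inverse (d i)) * mat_adjoint U"
  have GR: "G * R = U * real_diag n (\<lambda>i. inverse (d i) * d i) * mat_adjoint U"
    unfolding G_def R by (simp add: conj_real_diag_mult[OF U(1,2)])
  show thesis
  proof (rule that)
    show "G \<in> carrier_mat n n" by (rule carrier_matI) (simp_all add: G_def)
    show "mat_adjoint G = G" by (simp add: G_def mat_adjoint_simps mat_mult_assoc)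
    show "G * R = R * G" unfolding G_def R by (simp add: conj_real_diag_mult[OF U(1,2)] mult.commute)
    have "inverse (d i) * d i * d i = d i" for i by (cases "d i = 0") auto
    then show "G * R * R = R" unfolding GR unfolding R by (simp only: conj_real_diag_mult[OF U(1,2)])
    let ?e = "\<lambda>i. 1 - inverse (d i) * d i"
    have one: "real_diag n (\<lambda>i. 1) = 1\<^sub>m n" by (rule eq_matI) (auto simp: real_diag_def)
    have "real_diag n ?e = real_diag n (\<lambda>i. 1) - real_diag n (\<lambda>i. inverse (d i) * d i)"
      by (rule eq_matI) (auto simp: real_diag_def)
    then have "U * real_diag n ?e * mat_adjoint U = 1\<^sub>m n - G * R"
      unfolding GR one by (simp add: mat_minus_mult mat_mult_minus U)
    moreover have "0 \<le> ?e i" for i using d[of i] by (cases "d i = 0") auto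
    ultimately show "psd n (1\<^sub>m n - G * R)"
      using psd_congruence[OF psd_real_diag U(1), of ?e] by simp
  qed
qed

lemma psd_le_scalar:
  assumes "psd n A"
  obtains c :: real where "0 < c" "psd n (of_real c \<cdot>\<^sub>m 1\<^sub>m n - A)"
proof -
  obtain U d where U: "U \<in> carrier_mat n n" "mat_adjoint U * U = 1\<^sub>m n" "U * mat_adjoint U = 1\<^sub>m n"
    and A: "A = U * real_diag n d * mat_adjoint U" and d: "\<And>i. 0 \<le> d i"
    using psd_spectral[OF assms] by metis
  have [simp]: "dim_row U = n" "dim_col U = n" using U by simp_all
  \<comment> \<open>The sum dominates each eigenvalue; the extra 1 keeps \<open>c\<close> positive
    even for \<open>A = 0\<close>, since \<open>3 / c\<close> is formed later.\<close>
  define c where "c = 1 + (\<Sum>i<n. d i)"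
  have c: "d i \<le> c" if "i < n" for i
    using member_le_sum[of i "{..<n}" d] d that unfolding c_def by auto
  have "real_diag n (\<lambda>i. max 0 (c - d i)) = of_real c \<cdot>\<^sub>m 1\<^sub>m n - real_diag n d"
    using c by (intro eq_matI) (auto simp: real_diag_def max_def)
  then have "U * real_diag n (\<lambda>i. max 0 (c - d i)) * mat_adjoint U = of_real c \<cdot>\<^sub>m 1\<^sub>m n - A"
    unfolding A by (simp add: mat_minus_mult mat_mult_minus mat_smult_mult mat_mult_smult U)
  moreover have "psd n (U * real_diag n (\<lambda>i. max 0 (c - d i)) * mat_adjoint U)"
    by (rule psd_congruence[OF psd_real_diag U(1)]) simp
  moreover have "0 < c" unfolding c_def by (simp add: add_pos_nonneg sum_nonneg d)
  ultimately show thesis using that by simp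
qed

text \<open>If A = C C*, the transpose is the Gram matrix of the entrywise conjugate of
  \<open>C\<close>.\<close>

lemma psd_transpose:
  assumes "psd n A"
  shows "psd n (transpose_mat A)"
proof -
  obtain C where C: "psd n C" "C * C = A" using psd_sqrt_exists[OF assms] by blast
  have [simp]: "dim_row C = n" "dim_col C = n" using C by (simp_all add: psd_dim)
  have "A = C * mat_adjoint C" using C by (simp add: psd_hermitian)
  then have "transpose_mat A = map_mat cnj C * mat_adjoint (map_mat cnj C)"
    by (intro eq_matI) (simp_all add: index_mult_mat_sum mult.commute del: index_mult_mat(1))
  then show ?thesis using psd_gram[of "map_mat cnj C" n n] by (simp add: carrier_matI)
qed

text \<open>With \<open>Z = W\<^sup>* W\<close> one has \<open>1 - Z = (1 - Z)\<^sup>2 + W\<^sup>* (1 - W W\<^sup>*) W\<close>.\<close>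

lemma contraction_adjoint:
  assumes W: "W \<in> carrier_mat n m" and psd: "psd n (1\<^sub>m n - W * mat_adjoint W)"
  shows "psd m (1\<^sub>m m - mat_adjoint W * W)"
proof -
  have [simp]: "dim_row W = n" "dim_col W = m" using W by simp_all
  define Y where "Y = 1\<^sub>m m - mat_adjoint W * W"
  have Y: "Y \<in> carrier_mat m m" by (rule carrier_matI) (simp_all add: Y_def)
  have "Y * mat_adjoint Y + mat_adjoint W * (1\<^sub>m n - W * mat_adjoint W) * mat_adjoint (mat_adjoint W) = Y"
    unfolding Y_def by (rule eq_matI)
      (simp_all add: mat_ring_simps mat_adjoint_simps del: index_mult_mat(1) index_one_mat(1))
  then show ?thesis
    using psd_add[OF psd_gram[OF Y] psd_congruence[OF psd, of "mat_adjoint W" m]] W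
    by (simp add: Y_def)
qed

text \<open>\<open>W\<close> is the adjoint of the partial isometry in the polar decomposition of
  \<open>T\<close>, built from the pseudo-inverse \<open>G\<close> of R = |T|: W T = G R R = R, and
  W W* is the projection \<open>G * R\<close>. This is the attained half of the duality between
  trace norm and contractions; \<open>trace_mult_contraction_le\<close> is the bound.\<close>

lemma polar_trace:
  assumes T: "T \<in> carrier_mat p n" and R: "psd n R" "R * R = mat_adjoint T * T"
  obtains W where "W \<in> carrier_mat n p" "psd p (1\<^sub>m p - mat_adjoint W * W)"
    "mat_trace (W * T) = mat_trace R"
proof -
  obtain G where G: "G \<in> carrier_mat n n" "mat_adjoint G = G" "G * R = R * G" "G * R * R = R"
    "psd n (1\<^sub>m n - G * R)"
    using psd_pseudo_inverse[OF R(1)] .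
  have [simp]: "dim_row T = p" "dim_col T = n" "dim_row R = n" "dim_col R = n" "dim_row G = n" "dim_col G = n"
    using T R G by (simp_all add: psd_dim)
  define W where "W = G * mat_adjoint T"
  have W: "W \<in> carrier_mat n p" by (rule carrier_matI) (simp_all add: W_def)
  have WT: "W * T = R" unfolding W_def using G(4) by (simp add: mat_mult_assoc R(2))
  have "W * mat_adjoint W = W * T * G" by (simp add: W_def mat_adjoint_simps G mat_mult_assoc)
  also have "\<dots> = G * R" unfolding WT by (simp add: G)
  finally have "psd n (1\<^sub>m n - W * mat_adjoint W)" using G by simp
  then show thesis using that W contraction_adjoint[OF W] WT by blast
qed

text \<open>With \<open>G\<close> the pseudo-inverse of \<open>R\<close> and \<open>P = G R\<close>, \<open>P A = A\<close> gives
  \<open>tr (A W) = tr (X\<^sup>* Y)\<close> for \<open>X\<^sup>* = R\<^bsup>1/2\<^esup> G A\<close> and \<open>Y = W R\<^bsup>1/2\<^esup>\<close>, and then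
  \<open>2 Re tr (X\<^sup>* Y) \<le> tr (X\<^sup>* X) + tr (Y\<^sup>* Y) \<le> 2 tr R\<close>.\<close>

lemma trace_mult_contraction_le:
  assumes A: "A \<in> carrier_mat n p" and R: "psd n R" "R * R = A * mat_adjoint A"
    and W: "W \<in> carrier_mat p n" "psd n (1\<^sub>m n - mat_adjoint W * W)"
  shows "Re (mat_trace (A * W)) \<le> Re (mat_trace R)"
proof -
  obtain G where G: "G \<in> carrier_mat n n" "mat_adjoint G = G" "G * R = R * G" "G * R * R = R"
    "psd n (1\<^sub>m n - G * R)"
    using psd_pseudo_inverse[OF R(1)] .
  define S where "S = psd_sqrt R"
  have S: "psd n S" "S * S = R" using R by (simp_all add: S_def psd_psd_sqrt psd_sqrt_mult_self)
  have d [simp]: "dim_row A = n" "dim_col A = p" "dim_row R = n" "dim_col R = n" "dim_row G = n"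
    "dim_col G = n" "dim_row W = p" "dim_col W = n" "dim_row S = n" "dim_col S = n"
    using A R G W S by (simp_all add: psd_dim)
  note adj [simp] = G(2) psd_hermitian[OF R(1)] psd_hermitian[OF S(1)]
  \<comment> \<open>\<open>Z\<close> is the component of \<open>A\<close> outside the range of
    \<open>R\<close>. Since A A* = R R, it satisfies Z Z* = 0, which gives P A = A.\<close>
  define Z where "Z = A - R * G * A"
  have [simp]: "dim_row Z = n" "dim_col Z = p" by (simp_all add: Z_def)
  have RGR: "R * (G * R) = R" using G(3,4) by (simp add: mat_mult_assoc)
  have GRR: "G * (R * R) = R" using G(4) by (simp add: mat_mult_assoc)
  have "Z * mat_adjoint Z = (1\<^sub>m n - R * G) * (A * mat_adjoint A) * (1\<^sub>m n - G * R)"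
    unfolding Z_def
    by (rule eq_matI) (simp_all add: mat_ring_simps mat_adjoint_simps del: index_mult_mat(1) index_one_mat(1))
  also have "\<dots> = (R * R - R * (G * (R * R))) * (1\<^sub>m n - G * R)"
    unfolding R(2)[symmetric] by (simp add: mat_minus_mult mat_mult_assoc)
  also have "\<dots> = 0\<^sub>m n n" unfolding GRR by (simp add: mat_minus_self)
  finally have "mat_trace (mat_adjoint (mat_adjoint Z) * mat_adjoint Z) = 0" by (simp add: mat_trace_def)
  then have "mat_adjoint Z = 0\<^sub>m p n" using mat_trace_mult_adjoint_eq_0[of "mat_adjoint Z"] by simp
  then have "Z = 0\<^sub>m n p" using mat_adjoint_adjoint[of Z] by simp
  then have RGA: "A = R * G * A" unfolding Z_def by (rule mat_minus_eq_0_imp_eq) simp_all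
  define X where "X = mat_adjoint A * G * S"
  define Y where "Y = W * S"
  have [simp]: "dim_row X = p" "dim_col X = n" "dim_row Y = p" "dim_col Y = n"
    by (simp_all add: X_def Y_def)
  have XX: "mat_adjoint X * X = S * (G * R) * S"
  proof -
    have "mat_adjoint X * X = S * (G * (A * mat_adjoint A)) * G * S"
      by (simp add: X_def mat_adjoint_simps mat_mult_assoc)
    also have "G * (A * mat_adjoint A) = R" unfolding R(2)[symmetric] by (rule GRR)
    finally show ?thesis by (simp add: G(3) mat_mult_assoc)
  qed
  have "mat_trace (mat_adjoint X * X) = mat_trace (S * (S * (G * R)))"
    unfolding XX by (subst mat_trace_comm) simp_all
  also have "S * (S * (G * R)) = R" using RGR by (simp add: S(2)[symmetric] mat_mult_assoc)
  finally have trX: "mat_trace (mat_adjoint X * X) = mat_trace R" .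
  have "mat_trace (mat_adjoint Y * Y) = mat_trace (S * (S * (mat_adjoint W * W)))"
    using mat_trace_comm[of "S * (mat_adjoint W * W)" S] by (simp add: Y_def mat_adjoint_simps mat_mult_assoc)
  also have "S * (S * (mat_adjoint W * W)) = R * (mat_adjoint W * W)"
    by (simp add: S(2)[symmetric] mat_mult_assoc)
  finally have "mat_trace R - mat_trace (mat_adjoint Y * Y) = mat_trace (R * (1\<^sub>m n - mat_adjoint W * W))"
    by (simp add: mat_mult_minus mat_trace_minus)
  then have trY: "Re (mat_trace (mat_adjoint Y * Y)) \<le> Re (mat_trace R)"
    using psd_trace_mult_nonneg[OF R(1) W(2)]
    by (metis less_eq_complex_def minus_complex.sel(1) diff_ge_0_iff_ge zero_complex.sel(1))
  have "mat_trace (A * W) = mat_trace (S * (S * (G * A * W)))"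
    by (subst RGA) (simp add: S(2)[symmetric] mat_mult_assoc)
  also have "\<dots> = mat_trace (S * (G * A * W) * S)"
    by (subst mat_trace_comm) simp_all
  also have "S * (G * A * W) * S = mat_adjoint X * Y"
    by (simp add: X_def Y_def mat_adjoint_simps mat_mult_assoc)
  finally have tr: "mat_trace (A * W) = mat_trace (mat_adjoint X * Y)" .
  have "mat_trace (mat_adjoint Y * X) = cnj (mat_trace (mat_adjoint X * Y))"
    using mat_trace_adjoint[of "mat_adjoint X * Y"] by (simp add: mat_adjoint_simps)
  moreover have "mat_trace (mat_adjoint (X - Y) * (X - Y)) = mat_trace (mat_adjoint X * X) -
      mat_trace (mat_adjoint X * Y) - (mat_trace (mat_adjoint Y * X) - mat_trace (mat_adjoint Y * Y))"
    by (simp add: mat_adjoint_minus mat_minus_mult mat_mult_minus mat_trace_minus)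
  moreover have "0 \<le> Re (mat_trace (mat_adjoint (X - Y) * (X - Y)))"
    using mat_trace_mult_adjoint_nonneg[of "X - Y"] by (simp add: less_eq_complex_def)
  ultimately show ?thesis using trX trY tr by simp
qed

subsection \<open>Tensor products and partial traces\<close>

lemma sum_lessThan_mult:
  fixes f :: "nat \<Rightarrow> 'a::comm_monoid_add"
  shows "(\<Sum>i<m * n. f i) = (\<Sum>a<m. \<Sum>c<n. f (a * n + c))"
proof (induction m)
  case (Suc m)
  have split: "(\<Sum>i<k + l. f i) = (\<Sum>i<k. f i) + (\<Sum>c<l. f (k + c))" for k l
    by (induction l) (simp_all add: add.assoc)
  have "(\<Sum>i<Suc m * n. f i) = (\<Sum>i<m * n + n. f i)" by (simp add: add.commute)
  then show ?case using Suc by (simp add: split)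
qed simp

lemma pair_index_less [simp]:
  assumes "a < m" "c < n"
  shows "a * n + c < m * (n::nat)"
proof -
  have "a * n + c < Suc a * n" using assms by simp
  also have "\<dots> \<le> m * n" using assms by (intro mult_le_mono1) simp
  finally show ?thesis .
qed

lemma div_less_of_less_mult [simp]: "i < m * n \<Longrightarrow> i div n < (m::nat)"
  by (simp add: less_mult_imp_div_less)

lemma mod_less_of_less_mult [simp]: "i < m * n \<Longrightarrow> i mod n < (n::nat)"
  by (metis mod_less_divisor mult_0_right not_less0 gr0I)

lemma dim_tensor [simp]: "dim_row (A \<Otimes> B) = dim_row A * dim_row B" "dim_col (A \<Otimes> B) = dim_col A * dim_col B"
  by (simp_all add: tensor_def)

lemma index_one_tensor:
  "i < p * dim_row X \<Longrightarrow> j < p * dim_col X \<Longrightarrow>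
    (1\<^sub>m p \<Otimes> X) $$ (i, j) =
      (if i div dim_row X = j div dim_col X then X $$ (i mod dim_row X, j mod dim_col X) else 0)"
  by (simp add: tensor_def)

lemma one_tensor_mult:
  assumes "dim_col X = dim_row Y"
  shows "(1\<^sub>m p \<Otimes> X) * (1\<^sub>m p \<Otimes> Y) = 1\<^sub>m p \<Otimes> (X * Y)"
proof (rule eq_matI)
  fix i j assume "i < dim_row (1\<^sub>m p \<Otimes> (X * Y))" "j < dim_col (1\<^sub>m p \<Otimes> (X * Y))"
  then have ij: "i < p * dim_row X" "j < p * dim_col Y" by simp_all
  have "((1\<^sub>m p \<Otimes> X) * (1\<^sub>m p \<Otimes> Y)) $$ (i, j) = (\<Sum>a<p. \<Sum>c<dim_row Y.
      (if i div dim_row X = a then X $$ (i mod dim_row X, c) else 0) *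
      (if a = j div dim_col Y then Y $$ (c, j mod dim_col Y) else 0))"
    using assms ij by (simp add: index_mult_mat_sum sum_lessThan_mult index_one_tensor
        cong: if_cong del: index_mult_mat(1))
  also have "\<dots> = (\<Sum>a<p. if i div dim_row X = a then \<Sum>c<dim_row Y.
      X $$ (i mod dim_row X, c) * (if a = j div dim_col Y then Y $$ (c, j mod dim_col Y) else 0) else 0)"
    by (intro sum.cong refl) simp
  also have "\<dots> = (\<Sum>c<dim_row Y. X $$ (i mod dim_row X, c) *
      (if i div dim_row X = j div dim_col Y then Y $$ (c, j mod dim_col Y) else 0))"
    using ij by simp
  also have "\<dots> = (1\<^sub>m p \<Otimes> (X * Y)) $$ (i, j)"
    using assms ij by (simp add: index_one_tensor index_mult_mat_sum del: index_mult_mat(1))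
  finally show "((1\<^sub>m p \<Otimes> X) * (1\<^sub>m p \<Otimes> Y)) $$ (i, j) = (1\<^sub>m p \<Otimes> (X * Y)) $$ (i, j)" .
qed auto

lemma one_tensor_adjoint: "mat_adjoint (1\<^sub>m p \<Otimes> X) = 1\<^sub>m p \<Otimes> mat_adjoint X"
  by (rule eq_matI) (auto simp: index_one_tensor)

lemma one_tensor_smult: "1\<^sub>m p \<Otimes> (c \<cdot>\<^sub>m X) = c \<cdot>\<^sub>m (1\<^sub>m p \<Otimes> X)"
  by (rule eq_matI) (auto simp: index_one_tensor)

lemma smult_one_tensor: "(c \<cdot>\<^sub>m 1\<^sub>m p) \<Otimes> X = c \<cdot>\<^sub>m (1\<^sub>m p \<Otimes> X)"
  by (rule eq_matI) (auto simp: tensor_def)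

lemma psd_one_tensor:
  assumes "psd n X"
  shows "psd (p * n) (1\<^sub>m p \<Otimes> X)"
proof -
  obtain Y where Y: "psd n Y" "Y * Y = X" using psd_sqrt_exists[OF assms] by blast
  then have "1\<^sub>m p \<Otimes> X = (1\<^sub>m p \<Otimes> Y) * mat_adjoint (1\<^sub>m p \<Otimes> Y)"
    by (simp add: one_tensor_adjoint one_tensor_mult psd_hermitian psd_dim)
  then show ?thesis
    using psd_gram[of "1\<^sub>m p \<Otimes> Y" "p * n" "p * n", OF carrier_matI] Y by (simp add: psd_dim)
qed

section \<open>Partial trace over the first factor\<close>

definition ptrace_first :: "nat \<Rightarrow> nat \<Rightarrow> complex mat \<Rightarrow> complex mat" where
  "ptrace_first p r E = mat r r (\<lambda>(c, c'). \<Sum>a<p. E $$ (a * r + c, a * r + c'))"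

lemma dim_ptrace_first [simp]: "dim_row (ptrace_first p r E) = r" "dim_col (ptrace_first p r E) = r"
  by (simp_all add: ptrace_first_def)

text \<open>The partial trace is adjoint to tensoring with the identity under the trace pairing.
  This links the primal constraint \<rho> \<le> 1 \<otimes> X with the dual constraint that the
  partial trace of \<open>E\<close> is at most 1.\<close>

lemma mat_trace_one_tensor_mult:
  assumes [simp]: "dim_row X = r" "dim_col X = r" "dim_row E = p * r" "dim_col E = p * r"
  shows "mat_trace ((1\<^sub>m p \<Otimes> X) * E) = mat_trace (X * ptrace_first p r E)"
proof -
  have "mat_trace ((1\<^sub>m p \<Otimes> X) * E) = (\<Sum>a<p. \<Sum>c<r. \<Sum>a'<p. \<Sum>c'<r.
      (if a = a' then X $$ (c, c') else 0) * E $$ (a' * r + c', a * r + c))"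
    by (simp add: mat_trace_mult sum_lessThan_mult index_one_tensor cong: if_cong)
  also have "\<dots> = (\<Sum>a<p. \<Sum>c<r. \<Sum>a'<p. if a = a' then
      \<Sum>c'<r. X $$ (c, c') * E $$ (a' * r + c', a * r + c) else 0)"
    by (intro sum.cong refl) simp
  also have "\<dots> = (\<Sum>a<p. \<Sum>c<r. \<Sum>c'<r. X $$ (c, c') * E $$ (a * r + c', a * r + c))"
    by (rule sum.cong[OF refl], rule sum.cong[OF refl]) simp
  also have "\<dots> = (\<Sum>c<r. \<Sum>c'<r. \<Sum>a<p. X $$ (c, c') * E $$ (a * r + c', a * r + c))"
    by (subst sum.swap, rule sum.cong[OF refl], rule sum.swap)
  also have "\<dots> = mat_trace (X * ptrace_first p r E)"
    by (simp add: mat_trace_mult ptrace_first_def sum_distrib_left)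
  finally show ?thesis .
qed

lemma ptrace_first_add:
  assumes "dim_row E = p * r" "dim_col E = p * r" "dim_row F = p * r" "dim_col F = p * r"
  shows "ptrace_first p r (E + F) = ptrace_first p r E + ptrace_first p r F"
  using assms by (intro eq_matI) (auto simp: ptrace_first_def sum.distrib)

lemma ptrace_first_adjoint:
  assumes "dim_row E = p * r" "dim_col E = p * r"
  shows "mat_adjoint (ptrace_first p r E) = ptrace_first p r (mat_adjoint E)"
  using assms by (intro eq_matI) (auto simp: ptrace_first_def)

lemma mat_trace_ptrace_first:
  assumes "dim_row E = p * r"
  shows "mat_trace (ptrace_first p r E) = mat_trace E"
  using assms by (simp add: mat_trace_def ptrace_first_def sum_lessThan_mult sum.swap[of _ "{..<p}"])

lemma psd_ptrace_first:
  assumes E: "psd (p * r) E"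
  shows "psd r (ptrace_first p r E)"
proof (rule psdI)
  show "ptrace_first p r E \<in> carrier_mat r r" by (rule carrier_matI) simp_all
  fix w :: "complex mat" assume w: "w \<in> carrier_mat r 1"
  have "0 \<le> mat_trace ((1\<^sub>m p \<Otimes> (w * mat_adjoint w)) * E)"
    by (intro psd_trace_mult_nonneg[OF psd_one_tensor[OF psd_gram[OF w]] E])
  also have "\<dots> = mat_trace ((w * mat_adjoint w) * ptrace_first p r E)"
    using w by (intro mat_trace_one_tensor_mult) (simp_all add: psd_dim[OF E])
  also have "\<dots> = mat_trace (ptrace_first p r E * (w * mat_adjoint w))"
    using w by (intro mat_trace_comm) auto
  finally show "0 \<le> mat_trace (ptrace_first p r E * (w * mat_adjoint w))" .
qed

text \<open>Exchanges the index of the second tensor factor of the domain with the index of the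
  codomain: both \<open>M\<close> and \<open>reshuffle p q r M\<close> hold the amplitudes of one vector in a triple
  tensor product.\<close>

definition reshuffle :: "nat \<Rightarrow> nat \<Rightarrow> nat \<Rightarrow> complex mat \<Rightarrow> complex mat" where
  "reshuffle p q r M = mat (p * r) q (\<lambda>(i, b). M $$ (i div r * q + b, i mod r))"

lemma dim_reshuffle [simp]: "dim_row (reshuffle p q r M) = p * r" "dim_col (reshuffle p q r M) = q"
  by (simp_all add: reshuffle_def)

lemma reshuffle_carrier [simp]: "reshuffle p q r M \<in> carrier_mat (p * r) q"
  by (rule carrier_matI) simp_all

lemma reshuffle_reshuffle:
  assumes "M \<in> carrier_mat (p * q) r"
  shows "reshuffle p r q (reshuffle p q r M) = M"
proof (rule eq_matI)
  fix i c assume "i < dim_row M" "c < dim_col M"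
  then have "i < p * q" "c < r" using assms by simp_all
  then show "reshuffle p r q (reshuffle p q r M) $$ (i, c) = M $$ (i, c)"
    by (simp add: reshuffle_def)
qed (use assms in simp_all)

text \<open>Both sides sum over the first factor and the column index of \<open>Y\<close>, but the
  Gram matrix conjugates the entry with the row index instead of the column index; hence the
  transpose. A reshuffled \<open>Y\<close> is thus a contraction iff the partial trace of Y Y* is at
  most 1.\<close>

lemma reshuffle_gram:
  assumes "Y \<in> carrier_mat (p * r) m"
  shows "mat_adjoint (reshuffle p r m Y) * reshuffle p r m Y =
    transpose_mat (ptrace_first p r (Y * mat_adjoint Y))"
proof (rule eq_matI)
  fix c c' assume "c < dim_row (transpose_mat (ptrace_first p r (Y * mat_adjoint Y)))"
    "c' < dim_col (transpose_mat (ptrace_first p r (Y * mat_adjoint Y)))"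
  then have "c < r" "c' < r" by simp_all
  then show "(mat_adjoint (reshuffle p r m Y) * reshuffle p r m Y) $$ (c, c') =
      transpose_mat (ptrace_first p r (Y * mat_adjoint Y)) $$ (c, c')"
    using assms by (simp add: index_mult_mat_sum sum_lessThan_mult reshuffle_def ptrace_first_def
        mult.commute[of "cnj _"] del: index_mult_mat(1))
qed simp_all

text \<open>Both sides are the sum of \<open>?s a b c k\<close> over all four indices, contracted in
  different orders. The number \<open>m\<close> of columns of \<open>K\<close> is kept free: it is
  \<open>q\<close> in the weak bound and \<open>p * r\<close> in the strong bound.\<close>

lemma mat_trace_reshuffle:
  assumes M: "M \<in> carrier_mat (p * q) r" and K: "K \<in> carrier_mat q m" and Y: "Y \<in> carrier_mat (p * r) m"
  shows "mat_trace (mat_adjoint M * (1\<^sub>m p \<Otimes> K) * reshuffle p r m Y) =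
    mat_trace (transpose_mat K * (mat_adjoint (reshuffle p q r M) * Y))"
proof -
  have [simp]: "dim_row M = p * q" "dim_col M = r" "dim_row K = q" "dim_col K = m"
    "dim_row Y = p * r" "dim_col Y = m" using M K Y by simp_all
  let ?s = "\<lambda>a b c k. cnj (M $$ (a * q + b, c)) * K $$ (b, k) * Y $$ (a * r + c, k)"
  have "mat_trace (mat_adjoint M * (1\<^sub>m p \<Otimes> K) * reshuffle p r m Y) =
    mat_trace (mat_adjoint M * ((1\<^sub>m p \<Otimes> K) * reshuffle p r m Y))"
    by (simp add: mat_mult_assoc)
  also have "\<dots> = (\<Sum>c<r. \<Sum>a<p. \<Sum>b<q. cnj (M $$ (a * q + b, c)) *
      (\<Sum>a'<p. \<Sum>k<m. (if a = a' then K $$ (b, k) else 0) * Y $$ (a' * r + c, k)))"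
    by (simp add: mat_trace_mult index_mult_mat_sum sum_lessThan_mult index_one_tensor reshuffle_def
        cong: if_cong del: index_mult_mat(1))
  also have "\<dots> = (\<Sum>c<r. \<Sum>a<p. \<Sum>b<q. cnj (M $$ (a * q + b, c)) *
      (\<Sum>a'<p. if a = a' then \<Sum>k<m. K $$ (b, k) * Y $$ (a' * r + c, k) else 0))"
    by (intro sum.cong arg_cong2[where f = "(*)"] refl) simp
  also have "\<dots> = (\<Sum>c<r. \<Sum>a<p. \<Sum>b<q. \<Sum>k<m. ?s a b c k)"
    by (intro sum.cong refl) (simp add: sum_distrib_left mult.assoc)
  also have "\<dots> = (\<Sum>k<m. \<Sum>b<q. \<Sum>a<p. \<Sum>c<r. ?s a b c k)"
  proof -
    have "(\<Sum>c<r. \<Sum>a<p. \<Sum>b<q. \<Sum>k<m. ?s a b c k) = (\<Sum>a<p. \<Sum>c<r. \<Sum>b<q. \<Sum>k<m. ?s a b c k)"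
      by (rule sum.swap)
    also have "\<dots> = (\<Sum>a<p. \<Sum>b<q. \<Sum>c<r. \<Sum>k<m. ?s a b c k)"
      by (intro sum.cong refl sum.swap)
    also have "\<dots> = (\<Sum>a<p. \<Sum>b<q. \<Sum>k<m. \<Sum>c<r. ?s a b c k)"
      by (intro sum.cong refl sum.swap)
    also have "\<dots> = (\<Sum>b<q. \<Sum>a<p. \<Sum>k<m. \<Sum>c<r. ?s a b c k)"
      by (rule sum.swap)
    also have "\<dots> = (\<Sum>b<q. \<Sum>k<m. \<Sum>a<p. \<Sum>c<r. ?s a b c k)"
      by (intro sum.cong refl sum.swap)
    also have "\<dots> = (\<Sum>k<m. \<Sum>b<q. \<Sum>a<p. \<Sum>c<r. ?s a b c k)"
      by (rule sum.swap)
    finally show ?thesis .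
  qed
  also have "\<dots> = mat_trace (transpose_mat K * (mat_adjoint (reshuffle p q r M) * Y))"
    by (simp add: mat_trace_mult index_mult_mat_sum sum_lessThan_mult reshuffle_def sum_distrib_left
        mult.assoc mult.left_commute del: index_mult_mat(1))
  finally show ?thesis .
qed

section \<open>Amplitude matrices of pure states\<close>

definition amplitudes :: "nat \<Rightarrow> nat \<Rightarrow> complex mat \<Rightarrow> complex mat" where
  "amplitudes n r \<psi> = mat n r (\<lambda>(i, c). \<psi> $$ (i * r + c, 0))"

lemma amplitudes_carrier [simp]: "amplitudes n r \<psi> \<in> carrier_mat n r"
  by (simp add: amplitudes_def)

lemma ptrace_last_gram:
  assumes "\<psi> \<in> carrier_mat (n * r) 1"
  shows "ptrace_last n r (\<psi> * mat_adjoint \<psi>) = amplitudes n r \<psi> * mat_adjoint (amplitudes n r \<psi>)"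
  using assms by (intro eq_matI)
    (auto simp: ptrace_last_def amplitudes_def index_mult_mat_sum simp del: index_mult_mat(1))

lemma ptrace_middle_gram:
  assumes "\<psi> \<in> carrier_mat (p * q * r) 1"
  shows "ptrace_middle p q r (\<psi> * mat_adjoint \<psi>) =
    reshuffle p q r (amplitudes (p * q) r \<psi>) * mat_adjoint (reshuffle p q r (amplitudes (p * q) r \<psi>))"
  using assms by (intro eq_matI)
    (auto simp: ptrace_middle_def amplitudes_def reshuffle_def index_mult_mat_sum simp del: index_mult_mat(1))

subsection \<open>Semidefinite duality\<close>

lemma psd_one: "psd n (1\<^sub>m n)"
  using psd_gram[of "1\<^sub>m n" n n] by simp

lemma psd_zero: "psd n (0\<^sub>m n n)"
  using psd_gram[of "0\<^sub>m n n" n n] by simp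

lemma psd_trace_nonneg: "psd n A \<Longrightarrow> 0 \<le> mat_trace A"
  using psd_trace_mult_nonneg[OF _ psd_one, of n A] by (simp add: psd_dim)

text \<open>Writing A = C C*, an entry is an inner product of two rows of \<open>C\<close>, bounded
  by the mean of their squared norms; the squared norms of all rows add up to the trace. This bounds
  the dual feasible set.\<close>

lemma psd_cmod_index_le_trace:
  assumes A: "psd n A" and ij: "i < n" "j < n"
  shows "cmod (A $$ (i, j)) \<le> Re (mat_trace A)"
proof -
  obtain C where C: "psd n C" "C * C = A" using psd_sqrt_exists[OF A] by blast
  have [simp]: "dim_row C = n" "dim_col C = n" using C by (simp_all add: psd_dim)
  have AC: "A = C * mat_adjoint C" using C by (simp add: psd_hermitian)
  define s where "s i = (\<Sum>k<n. (cmod (C $$ (i, k)))\<^sup>2)" for i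
  have s0: "0 \<le> s i" for i by (simp add: s_def sum_nonneg)
  have "cmod (A $$ (i, j)) = cmod (\<Sum>k<n. C $$ (i, k) * cnj (C $$ (j, k)))"
    using ij by (simp add: AC index_mult_mat_sum del: index_mult_mat(1))
  also have "\<dots> \<le> (\<Sum>k<n. cmod (C $$ (i, k)) * cmod (C $$ (j, k)))"
    by (rule order_trans[OF norm_sum]) (simp add: norm_mult)
  also have "\<dots> \<le> (\<Sum>k<n. ((cmod (C $$ (i, k)))\<^sup>2 + (cmod (C $$ (j, k)))\<^sup>2) / 2)"
  proof (rule sum_mono)
    fix k
    show "cmod (C $$ (i, k)) * cmod (C $$ (j, k)) \<le> ((cmod (C $$ (i, k)))\<^sup>2 + (cmod (C $$ (j, k)))\<^sup>2) / 2"
      using sum_squares_bound[of "cmod (C $$ (i, k))" "cmod (C $$ (j, k))"] by simp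
  qed
  also have "\<dots> = (s i + s j) / 2" by (simp add: s_def sum.distrib flip: sum_divide_distrib)
  also have "\<dots> \<le> (\<Sum>i<n. s i)"
    using member_le_sum[of i "{..<n}" s] member_le_sum[of j "{..<n}" s] ij s0 by simp
  also have "\<dots> = Re (mat_trace A)"
    using mat_trace_mult_adjoint[of C] by (simp add: s_def C psd_hermitian[OF C(1)])
  finally show ?thesis .
qed

lemma ptrace_first_mult_left:
  assumes "dim_row h = r" "dim_col h = r" "dim_row M = p * r" "dim_col M = p * r"
  shows "ptrace_first p r ((1\<^sub>m p \<Otimes> h) * M) = h * ptrace_first p r M"
proof (rule eq_matI)
  fix c c' assume "c < dim_row (h * ptrace_first p r M)" "c' < dim_col (h * ptrace_first p r M)"
  then have c: "c < r" "c' < r" using assms by simp_all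
  have "ptrace_first p r ((1\<^sub>m p \<Otimes> h) * M) $$ (c, c') = (\<Sum>a<p. \<Sum>a'<p. \<Sum>d<r.
      (if a = a' then h $$ (c, d) else 0) * M $$ (a' * r + d, a * r + c'))"
    using assms c by (simp add: ptrace_first_def index_mult_mat_sum sum_lessThan_mult index_one_tensor
        cong: if_cong del: index_mult_mat(1))
  also have "\<dots> = (\<Sum>a<p. \<Sum>a'<p. if a = a' then \<Sum>d<r. h $$ (c, d) * M $$ (a' * r + d, a * r + c') else 0)"
    by (intro sum.cong refl) simp
  also have "\<dots> = (\<Sum>a<p. \<Sum>d<r. h $$ (c, d) * M $$ (a * r + d, a * r + c'))"
    by (rule sum.cong[OF refl]) simp
  also have "\<dots> = (h * ptrace_first p r M) $$ (c, c')"
    using assms c by (simp add: ptrace_first_def index_mult_mat_sum sum_distrib_left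
        sum.swap[of _ "{..<r}"] del: index_mult_mat(1))
  finally show "ptrace_first p r ((1\<^sub>m p \<Otimes> h) * M) $$ (c, c') = (h * ptrace_first p r M) $$ (c, c')" .
qed (use assms in simp_all)

lemma ptrace_first_mult_right:
  assumes "dim_row h = r" "dim_col h = r" "dim_row M = p * r" "dim_col M = p * r"
  shows "ptrace_first p r (M * (1\<^sub>m p \<Otimes> h)) = ptrace_first p r M * h"
proof -
  have "mat_adjoint (ptrace_first p r (M * (1\<^sub>m p \<Otimes> h))) =
      ptrace_first p r ((1\<^sub>m p \<Otimes> mat_adjoint h) * mat_adjoint M)"
    using assms by (simp add: ptrace_first_adjoint mat_adjoint_mult one_tensor_adjoint)
  also have "\<dots> = mat_adjoint (ptrace_first p r M * h)"
    using assms by (simp add: ptrace_first_mult_left ptrace_first_adjoint mat_adjoint_mult)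
  finally show ?thesis by (metis mat_adjoint_adjoint)
qed

lemma one_tensor_minus:
  "dim_row X = dim_row Y \<Longrightarrow> dim_col X = dim_col Y \<Longrightarrow> 1\<^sub>m p \<Otimes> (X - Y) = (1\<^sub>m p \<Otimes> X) - (1\<^sub>m p \<Otimes> Y)"
  by (rule eq_matI) (auto simp: index_one_tensor)

lemma one_tensor_one: "1\<^sub>m p \<Otimes> 1\<^sub>m r = 1\<^sub>m (p * r)"
proof (rule eq_matI)
  fix i j assume "i < dim_row (1\<^sub>m (p * r) :: complex mat)" "j < dim_col (1\<^sub>m (p * r) :: complex mat)"
  then have ij: "i < p * r" "j < p * r" by simp_all
  have "i = j" if "i div r = j div r" "i mod r = j mod r"
    using that by (metis div_mult_mod_eq)
  then show "(1\<^sub>m p \<Otimes> 1\<^sub>m r) $$ (i, j) = 1\<^sub>m (p * r) $$ (i, j)"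
    using ij by (auto simp: index_one_tensor)
qed simp_all

text \<open>Positivity is an intersection of closed conditions, one for each test vector. The
  entries depend on a parameter through \<open>G\<close>, so that both dual constraints are
  covered.\<close>

lemma closed_psd:
  fixes G :: "'a::topological_space \<Rightarrow> nat \<times> nat \<Rightarrow> complex"
  assumes "\<And>i j. i < n \<Longrightarrow> j < n \<Longrightarrow> continuous_on UNIV (\<lambda>f. G f (i, j))"
  shows "closed {f. psd n (mat n n (G f))}"
proof -
  let ?q = "\<lambda>v f. \<Sum>i<n. \<Sum>j<n. G f (i, j) * v $ j * cnj (v $ i)"
  have "{f. psd n (mat n n (G f))} =
      (\<Inter>v\<in>carrier_vec n. {f. 0 \<le> Re (?q v f)} \<inter> {f. Im (?q v f) = 0})"
    by (auto simp: psd_def quadratic_form_eq_sum[of _ n] less_eq_complex_def)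
  moreover have "continuous_on UNIV (?q v)" for v
    using assms by (intro continuous_intros) simp_all
  then have "closed {f. 0 \<le> Re (?q v f)}" "closed {f. Im (?q v f) = 0}" for v
    by (rule closed_Collect_le[OF continuous_on_const continuous_on_Re],
        rule closed_Collect_eq[OF continuous_on_Im continuous_on_const])
  ultimately show ?thesis by (simp only:) (intro closed_INT closed_Int ballI)
qed

text \<open>Compactness: the constraint bounds the trace of \<open>F\<close> by \<open>r\<close>,
  hence all its entries, and the objective is continuous. Matrices are represented by functions on
  all index pairs, with the product topology.\<close>

lemma exists_dual_optimum:
  assumes rho: "\<rho> \<in> carrier_mat (p * r) (p * r)"
  obtains E where "psd (p * r) E" "psd r (1\<^sub>m r - ptrace_first p r E)"
    "\<And>F. psd (p * r) F \<Longrightarrow> psd r (1\<^sub>m r - ptrace_first p r F) \<Longrightarrow>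
      Re (mat_trace (\<rho> * F)) \<le> Re (mat_trace (\<rho> * E))"
proof -
  define n where "n = p * r"
  \<comment> \<open>A square containing the disc of radius \<open>r\<close>, so that compactness
    reduces to that of intervals; \<open>K\<close> is then compact by Tychonoff.\<close>
  define Q where "Q = (\<lambda>z. Complex (fst z) (snd z)) ` ({- real r..real r} \<times> {- real r..real r})"
  define K where "K = Pi UNIV (\<lambda>_ :: nat \<times> nat. Q)"
  define P where "P f \<longleftrightarrow> psd n (mat n n f) \<and> psd r (1\<^sub>m r - ptrace_first p r (mat n n f))" for f
  have cont [continuous_intros]: "continuous_on S (\<lambda>f :: nat \<times> nat \<Rightarrow> complex. f x)" for x S
    by (rule continuous_on_subset[OF continuous_on_product_coordinates]) simp
  have "compact Q"
    unfolding Q_def by (intro compact_continuous_image compact_Times compact_Icc)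
      (intro continuous_intros)
  then have "compact K"
    using compactin_PiE[of "\<lambda>_ :: nat \<times> nat. euclidean" UNIV "\<lambda>_. Q"]
    by (simp add: K_def PiE_UNIV_domain euclidean_product_topology)
  moreover have "closed {f. P f}"
  proof -
    have "1\<^sub>m r - ptrace_first p r (mat n n f) =
        mat r r (\<lambda>x. of_bool (fst x = snd x) - (\<Sum>a<p. f (a * r + fst x, a * r + snd x)))" for f
      by (rule eq_matI) (auto simp: ptrace_first_def n_def)
    then have "{f. P f} = {f. psd n (mat n n f)} \<inter>
        {f. psd r (mat r r (\<lambda>x. of_bool (fst x = snd x) - (\<Sum>a<p. f (a * r + fst x, a * r + snd x))))}"
      by (auto simp: P_def)
    then show ?thesis
      by (simp only:) (intro closed_Int closed_psd continuous_intros)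
  qed
  ultimately have "compact ({f. P f} \<inter> K)" by (rule closed_Int_compact[rotated])
  moreover have "(\<lambda>_. 0) \<in> {f. P f} \<inter> K"
  proof -
    have "mat n n (\<lambda>_. 0) = (0\<^sub>m n n :: complex mat)" by (rule eq_matI) auto
    moreover have "ptrace_first p r (0\<^sub>m n n) = 0\<^sub>m r r"
      by (rule eq_matI) (auto simp: ptrace_first_def n_def)
    moreover have "1\<^sub>m r - 0\<^sub>m r r = (1\<^sub>m r :: complex mat)" by (rule eq_matI) auto
    moreover have "(0 :: complex) \<in> Q"
      unfolding Q_def by (rule image_eqI[of _ _ "(0, 0)"]) (simp_all add: complex_eq_iff)
    ultimately show ?thesis by (simp add: P_def K_def psd_zero psd_one)
  qed
  moreover have "continuous_on ({f. P f} \<inter> K) (\<lambda>f. Re (mat_trace (\<rho> * mat n n f)))"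
    using rho by (simp add: mat_trace_mult n_def) (intro continuous_intros)
  ultimately obtain f where f: "P f" and max: "\<And>g. P g \<Longrightarrow> g \<in> K \<Longrightarrow>
      Re (mat_trace (\<rho> * mat n n g)) \<le> Re (mat_trace (\<rho> * mat n n f))"
    using continuous_attains_sup[of "{f. P f} \<inter> K" "\<lambda>f. Re (mat_trace (\<rho> * mat n n f))"] by blast
  show thesis
  proof (rule that)
    show "psd (p * r) (mat n n f)" "psd r (1\<^sub>m r - ptrace_first p r (mat n n f))"
      using f by (simp_all add: P_def n_def)
    fix F assume F: "psd (p * r) F" "psd r (1\<^sub>m r - ptrace_first p r F)"
    \<comment> \<open>The value 0 outside the matrix keeps \<open>g\<close> inside \<open>K\<close>,
      which constrains every index pair.\<close>
    define g where "g x = (if fst x < n \<and> snd x < n then F $$ x else 0)" for x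
    have Fg: "mat n n g = F"
      using F(1) by (intro eq_matI) (simp_all add: g_def psd_dim n_def)
    have "0 \<le> mat_trace (1\<^sub>m r - ptrace_first p r F)" by (rule psd_trace_nonneg[OF F(2)])
    also have "\<dots> = of_nat r - mat_trace F"
      using F(1) by (simp add: mat_trace_minus mat_trace_ptrace_first psd_dim) (simp add: mat_trace_def)
    finally have "Re (mat_trace F) \<le> real r" by (simp add: less_eq_complex_def)
    then have "cmod (F $$ (i, j)) \<le> real r" if "i < n" "j < n" for i j
      using psd_cmod_index_le_trace[OF F(1), of i j] that by (simp add: n_def)
    then have g: "cmod (g x) \<le> real r" for x by (cases x) (simp add: g_def)
    have "g x \<in> Q" for x
      unfolding Q_def
    proof (rule image_eqI[of _ _ "(Re (g x), Im (g x))"])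
      show "(Re (g x), Im (g x)) \<in> {- real r..real r} \<times> {- real r..real r}"
        using abs_Re_le_cmod[of "g x"] abs_Im_le_cmod[of "g x"] g[of x] by (simp add: abs_le_iff)
    qed simp
    then have "g \<in> K" by (simp add: K_def)
    moreover have "P g" unfolding P_def Fg using F by (simp add: n_def)
    ultimately show "Re (mat_trace (\<rho> * F)) \<le> Re (mat_trace (\<rho> * mat n n f))"
      using max[of g] by (simp add: Fg)
  qed
qed

lemma linear_coefficient_nonpos:
  fixes \<alpha> \<beta> \<gamma> :: real
  assumes "0 < t0" and le: "\<And>t. 0 < t \<Longrightarrow> t \<le> t0 \<Longrightarrow> t * \<alpha> + t\<^sup>2 * \<beta> + t ^ 3 * \<gamma> \<le> 0"
  shows "\<alpha> \<le> 0"
proof (rule tendsto_upperbound)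
  show "((\<lambda>t. \<alpha> + t * \<beta> + t\<^sup>2 * \<gamma>) \<longlongrightarrow> \<alpha>) (at_right 0)"
    by (rule tendsto_eq_intros refl | simp)+
  have "\<alpha> + t * \<beta> + t\<^sup>2 * \<gamma> \<le> 0" if "0 < t" "t < t0" for t
  proof -
    have "t * (\<alpha> + t * \<beta> + t\<^sup>2 * \<gamma>) \<le> 0"
      using le[of t] that by (simp add: algebra_simps power2_eq_square power3_eq_cube)
    then show ?thesis using that by (simp add: mult_le_0_iff)
  qed
  then show "\<forall>\<^sub>F t in at_right 0. \<alpha> + t * \<beta> + t\<^sup>2 * \<gamma> \<le> 0"
    using \<open>0 < t0\<close> by (auto simp: eventually_at_right[of 0 t0])
qed simp

text \<open>Matrix version of 1 - (1 - x/2)^2 (1 + x) = x^2 (3 - x) / 4 at x = t N.\<close>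

lemma psd_perturbation_factor:
  fixes t c :: real
  assumes N: "psd r N" and Nc: "psd r (of_real c \<cdot>\<^sub>m 1\<^sub>m r - N)" and t: "0 \<le> t" "t * c \<le> 3"
  defines "h \<equiv> 1\<^sub>m r - of_real (t / 2) \<cdot>\<^sub>m N"
  shows "psd r (1\<^sub>m r - h * (1\<^sub>m r + of_real t \<cdot>\<^sub>m N) * h)"
proof -
  have [simp]: "dim_row N = r" "dim_col N = r" using N by (simp_all add: psd_dim)
  \<comment> \<open>The factor 3 - t N is split as (3 - t c) + t (c - N), both terms being positive
    by hypothesis.\<close>
  let ?Z = "of_real ((3 - t * c) * t\<^sup>2 / 4) \<cdot>\<^sub>m 1\<^sub>m r + of_real (t ^ 3 / 4) \<cdot>\<^sub>m (of_real c \<cdot>\<^sub>m 1\<^sub>m r - N)"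
  have "psd r (N * ?Z * mat_adjoint N)"
    using t by (intro psd_congruence[OF psd_add[OF psd_smult[OF psd_one] psd_smult[OF Nc]] psd_carrier[OF N]]) simp_all
  moreover have "N * ?Z * mat_adjoint N = 1\<^sub>m r - h * (1\<^sub>m r + of_real t \<cdot>\<^sub>m N) * h"
    unfolding h_def psd_hermitian[OF N]
    by (rule eq_matI) (simp_all add: mat_ring_simps field_simps power2_eq_square power3_eq_cube
        del: index_mult_mat(1) index_one_mat(1))
  ultimately show ?thesis by simp
qed

text \<open>Expansion in powers of \<open>t\<close>. The linear coefficient is the gain from adding
  \<open>F\<close> minus the loss from the damping factor \<open>H\<close> that restores
  feasibility.\<close>

lemma mat_trace_perturbation:
  fixes \<rho> E F M :: "complex mat" and t :: real
  assumes [simp]: "dim_row \<rho> = n" "dim_col \<rho> = n" "dim_row E = n" "dim_col E = n"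
    "dim_row F = n" "dim_col F = n" "dim_row M = n" "dim_col M = n"
  defines "H \<equiv> 1\<^sub>m n - of_real (t / 2) \<cdot>\<^sub>m M"
  shows "Re (mat_trace (\<rho> * (H * (E + of_real t \<cdot>\<^sub>m F) * H))) =
    Re (mat_trace (\<rho> * E)) +
    t * (Re (mat_trace (\<rho> * F)) - (Re (mat_trace (\<rho> * (M * E))) + Re (mat_trace (\<rho> * (E * M)))) / 2) +
    t\<^sup>2 * ((Re (mat_trace (\<rho> * (M * (E * M)))) / 4) -
      (Re (mat_trace (\<rho> * (M * F))) + Re (mat_trace (\<rho> * (F * M)))) / 2) +
    t ^ 3 * (Re (mat_trace (\<rho> * (M * (F * M)))) / 4)"
  unfolding H_def
  by (simp add: mat_ring_simps mat_trace_simps field_simps power2_eq_square power3_eq_cube)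

text \<open>The dual of minimizing \<open>tr X\<close> subject to \<open>\<rho> \<le> 1 \<otimes> X\<close>.  The multiplier \<open>X\<close> is read off
  the first-order condition at a dual optimum \<open>E\<close>: for a rank-one \<open>F = w w\<^sup>*\<close> and
  \<open>N\<close> its partial trace, \<open>(1 - t N / 2) (E + t F) (1 - t N / 2)\<close> (with \<open>1 \<otimes> N\<close> for \<open>N\<close>) is
  again feasible for small \<open>t > 0\<close>, because \<open>(1 - x / 2)\<^sup>2 (1 + x) \<le> 1\<close> for \<open>0 \<le> x \<le> 3\<close>.\<close>

lemma strong_duality:
  assumes rho: "psd (p * r) \<rho>"
  obtains E X where "psd (p * r) E" "psd r (1\<^sub>m r - ptrace_first p r E)"
    "X \<in> carrier_mat r r" "psd (p * r) ((1\<^sub>m p \<Otimes> X) - \<rho>)" "mat_trace X = mat_trace (\<rho> * E)"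
proof -
  obtain E where E: "psd (p * r) E" and fE: "psd r (1\<^sub>m r - ptrace_first p r E)"
    and max: "\<And>F. psd (p * r) F \<Longrightarrow> psd r (1\<^sub>m r - ptrace_first p r F) \<Longrightarrow>
      Re (mat_trace (\<rho> * F)) \<le> Re (mat_trace (\<rho> * E))"
    using exists_dual_optimum[OF psd_carrier[OF rho]] by blast
  let ?n = "p * r"
  have [simp]: "dim_row \<rho> = ?n" "dim_col \<rho> = ?n" "dim_row E = ?n" "dim_col E = ?n"
    using rho E by (simp_all add: psd_dim)
  \<comment> \<open>Chosen so that tr (N X) is the first-order loss caused by the damping, with
    \<open>N\<close> the partial trace of \<open>F\<close>. Averaging the two orders makes
    \<open>X\<close> Hermitian, with the dual value as its trace.\<close>
  define X where "X = (1 / 2) \<cdot>\<^sub>m (ptrace_first p r (E * \<rho>) + ptrace_first p r (\<rho> * E))"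
  have X: "X \<in> carrier_mat r r" by (rule carrier_matI) (simp_all add: X_def)
  have [simp]: "dim_row X = r" "dim_col X = r" using X by simp_all
  have XH: "mat_adjoint X = X"
    unfolding X_def
    by (simp add: mat_adjoint_simps ptrace_first_adjoint psd_hermitian[OF rho] psd_hermitian[OF E])
      (rule eq_matI; simp add: algebra_simps)
  have trX: "mat_trace X = mat_trace (\<rho> * E)"
    using mat_trace_comm[of E \<rho>]
    by (simp add: X_def mat_trace_smult mat_trace_add mat_trace_ptrace_first)
  have "psd ?n ((1\<^sub>m p \<Otimes> X) - \<rho>)"
  proof (rule psd_hermitianI)
    show "(1\<^sub>m p \<Otimes> X) - \<rho> \<in> carrier_mat ?n ?n" by (rule carrier_matI) simp_all
    show "mat_adjoint ((1\<^sub>m p \<Otimes> X) - \<rho>) = (1\<^sub>m p \<Otimes> X) - \<rho>"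
      by (simp add: mat_adjoint_minus one_tensor_adjoint XH psd_hermitian[OF rho])
    fix w :: "complex mat" assume w: "w \<in> carrier_mat ?n 1"
    define F where "F = w * mat_adjoint w"
    define N where "N = ptrace_first p r F"
    define M where "M = 1\<^sub>m p \<Otimes> N"
    have F: "psd ?n F" unfolding F_def by (rule psd_gram[OF w])
    have N: "psd r N" unfolding N_def by (rule psd_ptrace_first[OF F])
    have [simp]: "dim_row F = ?n" "dim_col F = ?n" "dim_row N = r" "dim_col N = r"
      "dim_row M = ?n" "dim_col M = ?n"
      using F N by (simp_all add: psd_dim M_def)
    obtain c :: real where c: "0 < c" "psd r (of_real c \<cdot>\<^sub>m 1\<^sub>m r - N)" using psd_le_scalar[OF N] .
    define \<alpha> where "\<alpha> = Re (mat_trace (\<rho> * F)) - (Re (mat_trace (\<rho> * (M * E))) + Re (mat_trace (\<rho> * (E * M)))) / 2"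
    have "\<alpha> \<le> 0"
    proof (rule linear_coefficient_nonpos)
      \<comment> \<open>The range t \<le> 3 / c provides the premise t c \<le> 3 of
        \<open>psd_perturbation_factor\<close>.\<close>
      show "0 < 3 / c" using c by simp
      fix t :: real assume t: "0 < t" "t \<le> 3 / c"
      define h where "h = 1\<^sub>m r - of_real (t / 2) \<cdot>\<^sub>m N"
      define H where "H = 1\<^sub>m ?n - of_real (t / 2) \<cdot>\<^sub>m M"
      have [simp]: "dim_row h = r" "dim_col h = r" "dim_row H = ?n" "dim_col H = ?n"
        by (simp_all add: h_def H_def)
      have hH: "mat_adjoint h = h" "mat_adjoint H = H" "H = 1\<^sub>m p \<Otimes> h"
        by (simp_all add: h_def H_def M_def mat_adjoint_minus one_tensor_adjoint one_tensor_minus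
            one_tensor_smult one_tensor_one psd_hermitian[OF N])
      define E' where "E' = H * (E + of_real t \<cdot>\<^sub>m F) * H"
      have "psd ?n (H * (E + of_real t \<cdot>\<^sub>m F) * mat_adjoint H)"
        using t by (intro psd_congruence[OF psd_add[OF E psd_smult[OF F]]] carrier_matI) simp_all
      then have E': "psd ?n E'" unfolding E'_def hH(2) .
      have "ptrace_first p r E' = h * (ptrace_first p r E + of_real t \<cdot>\<^sub>m N) * h"
      proof -
        have "ptrace_first p r (of_real t \<cdot>\<^sub>m F) = of_real t \<cdot>\<^sub>m N"
          unfolding N_def by (rule eq_matI) (simp_all add: ptrace_first_def sum_distrib_left)
        then show ?thesis
          unfolding E'_def hH(3) by (simp add: ptrace_first_mult_left ptrace_first_mult_right ptrace_first_add)
      qed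
      \<comment> \<open>With f the partial trace of \<open>E\<close>, the slack 1 - h (f + t N) h
        splits into h (1 - f) h, positive by feasibility of \<open>E\<close>, and 1 - h (1 + t N) h,
        positive by the scalar inequality.\<close>
      then have eq: "1\<^sub>m r - ptrace_first p r E' = h * (1\<^sub>m r - ptrace_first p r E) * h +
          (1\<^sub>m r - h * (1\<^sub>m r + of_real t \<cdot>\<^sub>m N) * h)"
        by (simp add: mat_ring_simps) (rule eq_matI; simp del: index_mult_mat(1) index_one_mat(1))
      have "psd r (h * (1\<^sub>m r - ptrace_first p r E) * mat_adjoint h)"
        by (intro psd_congruence[OF fE] carrier_matI) simp_all
      moreover have "psd r (1\<^sub>m r - h * (1\<^sub>m r + of_real t \<cdot>\<^sub>m N) * h)"
        unfolding h_def using t c by (intro psd_perturbation_factor[OF N c(2)]) (simp_all add: field_simps)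
      ultimately have "psd r (1\<^sub>m r - ptrace_first p r E')"
        unfolding eq hH(1) by (rule psd_add)
      from max[OF E' this]
      show "t * \<alpha> + t\<^sup>2 * ((Re (mat_trace (\<rho> * (M * (E * M)))) / 4) -
          (Re (mat_trace (\<rho> * (M * F))) + Re (mat_trace (\<rho> * (F * M)))) / 2) +
          t ^ 3 * (Re (mat_trace (\<rho> * (M * (F * M)))) / 4) \<le> 0"
        unfolding E'_def H_def \<alpha>_def by (subst (asm) mat_trace_perturbation[of _ ?n]) simp_all
    qed
    \<comment> \<open>Adjointness of the partial trace turns \<open>\<alpha> \<le> 0\<close> into tr
      (\<rho> F) \<le> tr (N X) = tr ((1 \<otimes> X) F), which is positivity at
      \<open>w\<close>.\<close>
    moreover have "mat_trace (\<rho> * (M * E)) = mat_trace (N * ptrace_first p r (E * \<rho>))"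
    proof -
      have "mat_trace (\<rho> * (M * E)) = mat_trace (M * E * \<rho>)" by (rule mat_trace_comm) simp_all
      also have "\<dots> = mat_trace (M * (E * \<rho>))" by (simp add: mat_mult_assoc)
      finally show ?thesis
        unfolding M_def by (simp add: mat_trace_one_tensor_mult)
    qed
    moreover have "mat_trace (\<rho> * (E * M)) = mat_trace (N * ptrace_first p r (\<rho> * E))"
    proof -
      have "mat_trace (\<rho> * (E * M)) = mat_trace (M * (\<rho> * E))"
        using mat_trace_comm[of "\<rho> * E" M] by (simp add: mat_mult_assoc)
      then show ?thesis
        unfolding M_def by (simp add: mat_trace_one_tensor_mult)
    qed
    moreover have "mat_trace ((1\<^sub>m p \<Otimes> X) * F) = mat_trace (N * X)"
      using mat_trace_comm[of X N]
      by (simp add: mat_trace_one_tensor_mult N_def)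
    moreover have "mat_trace (N * X) = (mat_trace (N * ptrace_first p r (E * \<rho>)) +
        mat_trace (N * ptrace_first p r (\<rho> * E))) / 2"
      unfolding X_def by (simp add: mat_mult_smult mat_mult_add mat_trace_simps)
    ultimately have "Re (mat_trace (\<rho> * F)) \<le> Re (mat_trace ((1\<^sub>m p \<Otimes> X) * F))"
      unfolding \<alpha>_def by (simp only:) simp
    then show "0 \<le> Re (mat_trace (((1\<^sub>m p \<Otimes> X) - \<rho>) * (w * mat_adjoint w)))"
      unfolding F_def[symmetric] by (simp add: mat_minus_mult mat_trace_minus)
  qed
  then show thesis using that E fE X trX by blast
qed

subsection \<open>Purifications\<close>

lemma mat_trace_nonzero_diagonal:
  assumes "mat_trace A \<noteq> 0"
  obtains j where "j < dim_row A" "A $$ (j, j) \<noteq> 0"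
proof -
  have "\<exists>j<dim_row A. A $$ (j, j) \<noteq> 0"
    using assms unfolding mat_trace_def by (meson lessThan_iff sum.neutral)
  then show thesis using that by blast
qed

text \<open>Two distinct independent columns would force rank at least 2. Their dependence can be
  solved for column \<open>k\<close> because column \<open>j\<close> is nonzero.\<close>

lemma rank_eq_1_imp_col_multiple:
  fixes A :: "complex mat"
  assumes A: "A \<in> carrier_mat n n" and rank: "vec_space.rank n A = 1"
    and j: "j < n" "k < n" and nz: "A $$ (i, j) \<noteq> 0" "i < n"
  shows "\<exists>s. \<forall>l<n. A $$ (l, k) = s * A $$ (l, j)"
\<comment> \<open>Dependence is formulated for the set of columns, which collapses when the two
  coincide, so that case is treated apart.\<close>
proof (cases "col A k = col A j")
  case True
  have "A $$ (l, k) = A $$ (l, j)" if "l < n" for l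
    using arg_cong[OF True, of "\<lambda>v. v $ l"] A j that by simp
  then show ?thesis by (intro exI[of _ 1]) simp
next
  case False
  interpret vec_space "TYPE(complex)" n .
  let ?B = "mat_of_cols n [col A j, col A k]"
  have cols: "cols ?B = [col A j, col A k]" using A by (intro cols_mat_of_cols) (auto simp: col_def)
  have B: "?B \<in> carrier_mat n 2" by (rule carrier_matI) simp_all
  have "lin_dep (set (cols ?B))"
  proof (rule ccontr)
    assume "\<not> lin_dep (set (cols ?B))"
    moreover have "set (cols ?B) \<subseteq> set (cols A)" using A j by (auto simp: cols in_set_conv_nth cols_def)
    ultimately have "card (set (cols ?B)) \<le> rank A" by (intro rank_ge_card_indpt[OF A]) simp_all
    then show False using rank False by (simp add: cols)
  qed
  then obtain v where v: "v \<in> carrier_vec 2" "v \<noteq> 0\<^sub>v 2" "?B *\<^sub>v v = 0\<^sub>v n"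
    using lin_depE[OF B] False by (auto simp: cols)
  have eq: "A $$ (l, j) * v $ 0 + A $$ (l, k) * v $ 1 = 0" if "l < n" for l
  proof -
    have "(?B *\<^sub>v v) $ l = A $$ (l, j) * v $ 0 + A $$ (l, k) * v $ 1"
      using that v(1) A j by (simp add: scalar_prod_def mat_of_cols_def numeral_2_eq_2 mult.commute)
    then show ?thesis using v(3) that by simp
  qed
  have "v $ 1 \<noteq> 0"
  proof
    assume 0: "v $ 1 = 0"
    then have "v $ 0 = 0" using eq[OF nz(2)] nz by simp
    then have "v = 0\<^sub>v 2" using v(1) 0 by (intro eq_vecI) (auto simp: less_2_cases_iff)
    then show False using v by simp
  qed
  then have "A $$ (l, k) = - (v $ 0 / v $ 1) * A $$ (l, j)" if "l < n" for l
    using eq[OF that] by (simp add: field_simps eq_neg_iff_add_eq_0)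
  then show ?thesis by blast
qed

text \<open>Trace one yields a nonzero, hence positive, diagonal entry \<open>d\<close> in some
  column \<open>j\<close>; that column divided by \<open>sqrt d\<close> is the vector sought. Every
  column \<open>k\<close> is a multiple of column \<open>j\<close>, and hermiticity fixes the
  multiple as the conjugate of \<open>\<omega> $$ (k, j)\<close> over \<open>d\<close>.\<close>

lemma rank_one_density_gram:
  assumes w: "density n \<omega>" and rank: "vec_space.rank n \<omega> = 1"
  obtains \<psi> where "\<psi> \<in> carrier_mat n 1" "\<omega> = \<psi> * mat_adjoint \<psi>"
proof -
  have psd: "psd n \<omega>" and tr: "mat_trace \<omega> = 1" using w by (simp_all add: density_def)
  have [simp]: "dim_row \<omega> = n" "dim_col \<omega> = n" using psd by (simp_all add: psd_dim)
  obtain j where j: "j < n" "\<omega> $$ (j, j) \<noteq> 0"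
    using mat_trace_nonzero_diagonal[of \<omega>] tr by auto
  define d where "d = Re (\<omega> $$ (j, j))"
  have d: "\<omega> $$ (j, j) = of_real d" "0 < d"
    using psd_diagonal_nonneg[OF psd j(1)] j(2) by (auto simp: d_def less_eq_complex_def complex_eq_iff)
  have herm: "\<omega> $$ (i, k) = cnj (\<omega> $$ (k, i))" if "i < n" "k < n" for i k
    using arg_cong[OF psd_hermitian[OF psd], of "\<lambda>M. M $$ (i, k)"] that by simp
  define \<psi> where "\<psi> = mat n 1 (\<lambda>(i, c). \<omega> $$ (i, j) / of_real (sqrt d))"
  have "\<omega> = \<psi> * mat_adjoint \<psi>"
  proof (rule eq_matI)
    fix i k assume "i < dim_row (\<psi> * mat_adjoint \<psi>)" "k < dim_col (\<psi> * mat_adjoint \<psi>)"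
    then have ik: "i < n" "k < n" by (simp_all add: \<psi>_def)
    obtain s where s: "\<And>l. l < n \<Longrightarrow> \<omega> $$ (l, k) = s * \<omega> $$ (l, j)"
      using rank_eq_1_imp_col_multiple[OF psd_carrier[OF psd] rank j(1) ik(2) j(2) j(1)] by blast
    have "s * of_real d = cnj (\<omega> $$ (k, j))" using s[OF j(1)] herm[OF j(1) ik(2)] d by simp
    then have "\<omega> $$ (i, k) = \<omega> $$ (i, j) * cnj (\<omega> $$ (k, j)) / of_real d"
      using s[OF ik(1)] d by (simp add: field_simps)
    moreover have "(\<psi> * mat_adjoint \<psi>) $$ (i, k) =
        \<omega> $$ (i, j) * cnj (\<omega> $$ (k, j)) / (of_real (sqrt d) * of_real (sqrt d))"
      using ik by (simp add: \<psi>_def index_mult_mat_sum del: index_mult_mat(1))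
    moreover have "of_real (sqrt d) * of_real (sqrt d) = (of_real d :: complex)"
      using d(2) by (simp flip: of_real_mult)
    ultimately show "\<omega> $$ (i, k) = (\<psi> * mat_adjoint \<psi>) $$ (i, k)"
      by (simp only:)
  qed (simp_all add: \<psi>_def)
  moreover have "\<psi> \<in> carrier_mat n 1" by (simp add: \<psi>_def)
  ultimately show thesis using that by blast
qed

lemma rank_gram_eq_1:
  assumes \<psi>: "\<psi> \<in> carrier_mat n 1" and nz: "mat_trace (\<psi> * mat_adjoint \<psi>) \<noteq> 0"
  shows "vec_space.rank n (\<psi> * mat_adjoint \<psi>) = 1"
proof -
  interpret vec_space "TYPE(complex)" n .
  let ?A = "\<psi> * mat_adjoint \<psi>"
  have [simp]: "dim_row \<psi> = n" "dim_col \<psi> = 1" using \<psi> by simp_all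
  have A: "?A \<in> carrier_mat n n" by (rule carrier_matI) simp_all
  have "rank ?A \<le> 1"
    by (rule rank_le_1_product_entries[OF A, of "\<lambda>i. \<psi> $$ (i, 0)" "\<lambda>j. cnj (\<psi> $$ (j, 0))"])
      (simp add: index_mult_mat_sum del: index_mult_mat(1))
  moreover have "1 \<le> rank ?A"
  proof -
    obtain j where j: "j < n" "?A $$ (j, j) \<noteq> 0"
      using mat_trace_nonzero_diagonal[OF nz] by (auto simp del: index_mult_mat(1))
    let ?B = "mat_of_cols n [col ?A j]"
    have cols: "cols ?B = [col ?A j]" by (intro cols_mat_of_cols) (simp add: carrier_vecI)
    have B: "?B \<in> carrier_mat n 1" by (simp add: mat_of_cols_def)
    have "\<not> lin_dep (set (cols ?B))"
    proof
      assume "lin_dep (set (cols ?B))"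
      then obtain v where v: "v \<in> carrier_vec 1" "v \<noteq> 0\<^sub>v 1" "?B *\<^sub>v v = 0\<^sub>v n"
        using lin_depE[OF B] by (auto simp: cols)
      have "(?B *\<^sub>v v) $ j = ?A $$ (j, j) * v $ 0"
        using j v(1) by (simp add: scalar_prod_def mat_of_cols_def del: index_mult_mat(1))
      then have "v $ 0 = 0" using v(3) j by (simp del: index_mult_mat(1))
      then have "v = 0\<^sub>v 1" using v(1) by (intro eq_vecI) auto
      then show False using v by simp
    qed
    moreover have "set (cols ?B) \<subseteq> set (cols ?A)" using j unfolding cols by (simp add: cols_def)
    ultimately have "card (set (cols ?B)) \<le> rank ?A" by (intro rank_ge_card_indpt[OF A]) simp_all
    then show ?thesis by (simp add: cols)
  qed
  ultimately show ?thesis by simp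
qed

text \<open>The canonical purification: the square root of \<open>\<rho>\<close>, read as a vector,
  with a purifying system of the same dimension \<open>n\<close>.\<close>

lemma exists_purification:
  assumes "density n \<rho>"
  shows "\<exists>dC \<omega>. purification n dC \<rho> \<omega>"
proof -
  define C where "C = psd_sqrt \<rho>"
  have C: "psd n C" "C * C = \<rho>"
    using assms psd_psd_sqrt[of n \<rho>] psd_sqrt_mult_self[of n \<rho>] by (simp_all add: C_def density_def)
  have [simp]: "dim_row C = n" "dim_col C = n" using C by (simp_all add: psd_dim)
  define \<psi> where "\<psi> = mat (n * n) 1 (\<lambda>(i, j). C $$ (i div n, i mod n))"
  have \<psi>: "\<psi> \<in> carrier_mat (n * n) 1" by (simp add: \<psi>_def)
  have amp: "amplitudes n n \<psi> = C" by (rule eq_matI) (simp_all add: amplitudes_def \<psi>_def)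
  have "mat_trace (\<psi> * mat_adjoint \<psi>) = mat_trace (mat_adjoint C * C)"
    using mat_trace_mult_adjoint[of C]
    by (simp add: mat_trace_def index_mult_mat_sum \<psi>_def sum_lessThan_mult complex_norm_square
        del: index_mult_mat(1) of_real_power)
  then have tr: "mat_trace (\<psi> * mat_adjoint \<psi>) = 1"
    using assms by (simp add: psd_hermitian[OF C(1)] C density_def)
  have "purification n n \<rho> (\<psi> * mat_adjoint \<psi>)"
    unfolding purification_def density_def
    using tr rank_gram_eq_1[OF \<psi>] psd_gram[OF \<psi>]
    by (simp add: ptrace_last_gram[OF \<psi>] amp psd_hermitian[OF C(1)] C)
  then show ?thesis by blast
qed

subsection \<open>Fidelity and min-entropy\<close>

lemma mat_trace_cauchy_schwarz:
  fixes K L :: "complex mat"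
  assumes dims [simp]: "dim_row K = n" "dim_col K = m" "dim_row L = n" "dim_col L = m"
    and K: "mat_trace (mat_adjoint K * K) = 1"
  shows "(Re (mat_trace (mat_adjoint K * L)))\<^sup>2 \<le> Re (mat_trace (mat_adjoint L * L))"
proof -
  define x where "x = Re (mat_trace (mat_adjoint K * L))"
  \<comment> \<open>The residual of \<open>L\<close> after subtracting its real component along
    \<open>K\<close>; its squared norm is that of \<open>L\<close> minus
    \<open>x * x\<close>.\<close>
  define Z where "Z = L - of_real x \<cdot>\<^sub>m K"
  have "mat_trace (mat_adjoint L * K) = cnj (mat_trace (mat_adjoint K * L))"
    using mat_trace_adjoint[of "mat_adjoint K * L"] by (simp add: mat_adjoint_mult)
  moreover have "mat_trace (mat_adjoint Z * Z) = mat_trace (mat_adjoint L * L) -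
      of_real x * mat_trace (mat_adjoint L * K) - of_real x * mat_trace (mat_adjoint K * L) + of_real (x * x)"
    by (simp add: Z_def mat_adjoint_minus mat_ring_simps mat_trace_simps K algebra_simps)
  moreover have "0 \<le> Re (mat_trace (mat_adjoint Z * Z))"
    using mat_trace_mult_adjoint_nonneg[of Z] by (simp add: less_eq_complex_def)
  ultimately show ?thesis by (simp add: x_def power2_eq_square)
qed

lemma mat_adjoint_map_cnj [simp]: "mat_adjoint (map_mat cnj A) = transpose_mat A"
  by (rule eq_matI) simp_all

lemma mat_trace_adjoint_mult_map_cnj:
  "mat_trace (mat_adjoint (map_mat cnj A) * map_mat cnj A) = mat_trace (mat_adjoint A * A)"
  by (simp add: mat_trace_mult_adjoint del: mat_adjoint_map_cnj)

lemma psd_one_minus_transpose_iff: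
  assumes "dim_row A = r" "dim_col A = r"
  shows "psd r (1\<^sub>m r - transpose_mat A) \<longleftrightarrow> psd r (1\<^sub>m r - A)"
proof -
  have "transpose_mat (1\<^sub>m r - A) = 1\<^sub>m r - transpose_mat A" "transpose_mat (1\<^sub>m r - transpose_mat A) = 1\<^sub>m r - A"
    using assms by (auto intro!: eq_matI)
  then show ?thesis using psd_transpose by metis
qed

text \<open>Weak half: any state against any primal feasible \<open>X\<close>. The trace of
  \<open>R\<close> is attained at a contraction \<open>W\<close> and reshuffled to a pairing of
  \<open>K\<close> with \<Phi>* Y; Cauchy-Schwarz, feasibility of \<open>X\<close> and feasibility
  of Y Y* then bound its square in turn.\<close>

lemma fidelity_weak_bound:
  assumes Psi: "\<Psi> \<in> carrier_mat (p * q) r" and sigma: "density q \<sigma>"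
    and X: "psd r X" "psd (p * r) ((1\<^sub>m p \<Otimes> X) - reshuffle p q r \<Psi> * mat_adjoint (reshuffle p q r \<Psi>))"
    and R: "psd (p * q) R"
      "R * R = (1\<^sub>m p \<Otimes> psd_sqrt \<sigma>) * (\<Psi> * mat_adjoint \<Psi>) * (1\<^sub>m p \<Otimes> psd_sqrt \<sigma>)"
  shows "(Re (mat_trace R))\<^sup>2 \<le> Re (mat_trace X)"
proof -
  define K where "K = psd_sqrt \<sigma>"
  have K: "psd q K" "K * K = \<sigma>"
    using sigma psd_psd_sqrt[of q \<sigma>] psd_sqrt_mult_self[of q \<sigma>] by (simp_all add: K_def density_def)
  define S where "S = 1\<^sub>m p \<Otimes> K"
  have [simp]: "dim_row \<Psi> = p * q" "dim_col \<Psi> = r" "dim_row K = q" "dim_col K = q"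
    "dim_row S = p * q" "dim_col S = p * q" "dim_row X = r" "dim_col X = r"
    using Psi K X by (simp_all add: psd_dim S_def)
  have SH: "mat_adjoint S = S" by (simp add: S_def one_tensor_adjoint psd_hermitian[OF K(1)])
  have T: "mat_adjoint \<Psi> * S \<in> carrier_mat r (p * q)" by (rule carrier_matI) simp_all
  have "R * R = mat_adjoint (mat_adjoint \<Psi> * S) * (mat_adjoint \<Psi> * S)"
    using R(2) by (simp add: mat_adjoint_mult SH mat_mult_assoc K_def[symmetric] S_def[symmetric])
  then obtain W where W: "W \<in> carrier_mat (p * q) r" "psd r (1\<^sub>m r - mat_adjoint W * W)"
    and tr: "mat_trace (W * (mat_adjoint \<Psi> * S)) = mat_trace R"
    using polar_trace[OF T R(1)] by metis
  have [simp]: "dim_row W = p * q" "dim_col W = r" using W by simp_all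
  define Y where "Y = reshuffle p q r W"
  have Y: "Y \<in> carrier_mat (p * r) q" by (simp add: Y_def)
  have [simp]: "dim_row Y = p * r" "dim_col Y = q" by (simp_all add: Y_def)
  have WY: "W = reshuffle p r q Y" unfolding Y_def by (rule reshuffle_reshuffle[OF W(1), symmetric])
  have "psd r (1\<^sub>m r - ptrace_first p r (Y * mat_adjoint Y))"
    using W(2) unfolding WY reshuffle_gram[OF Y] by (simp add: psd_one_minus_transpose_iff)
  then have feasible: "0 \<le> mat_trace (X * (1\<^sub>m r - ptrace_first p r (Y * mat_adjoint Y)))"
    by (rule psd_trace_mult_nonneg[OF X(1)])
  define \<Phi> where "\<Phi> = reshuffle p q r \<Psi>"
  have [simp]: "dim_row \<Phi> = p * r" "dim_col \<Phi> = q" by (simp_all add: \<Phi>_def)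
  define L where "L = mat_adjoint \<Phi> * Y"
  have [simp]: "dim_row L = q" "dim_col L = q" by (simp_all add: L_def)
  have "mat_trace (W * (mat_adjoint \<Psi> * S)) = mat_trace (mat_adjoint \<Psi> * S * W)"
    by (rule mat_trace_comm) simp_all
  also have "\<dots> = mat_trace (transpose_mat K * L)"
    unfolding WY S_def L_def \<Phi>_def by (rule mat_trace_reshuffle[OF Psi psd_carrier[OF K(1)] Y])
  \<comment> \<open>The transpose of \<open>K\<close> is the adjoint of its entrywise conjugate, so
    this is a Hilbert-Schmidt inner product with a matrix of norm one.\<close>
  finally have trR: "mat_trace R = mat_trace (mat_adjoint (map_mat cnj K) * L)" using tr by simp
  have "mat_trace (mat_adjoint (map_mat cnj K) * map_mat cnj K) = 1"
    unfolding mat_trace_adjoint_mult_map_cnj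
    using sigma by (simp add: psd_hermitian[OF K(1)] K(2) density_def)
  then have "(Re (mat_trace R))\<^sup>2 \<le> Re (mat_trace (mat_adjoint L * L))"
    unfolding trR by (intro mat_trace_cauchy_schwarz[of _ q q]) simp_all
  also have "mat_trace (mat_adjoint L * L) = mat_trace (\<Phi> * mat_adjoint \<Phi> * (Y * mat_adjoint Y))"
    using mat_trace_comm[of "mat_adjoint Y" "\<Phi> * (mat_adjoint \<Phi> * Y)"]
    by (simp add: L_def mat_adjoint_mult mat_mult_assoc)
  also have "Re \<dots> \<le> Re (mat_trace ((1\<^sub>m p \<Otimes> X) * (Y * mat_adjoint Y)))"
    using psd_trace_gram_nonneg[OF X(2)[folded \<Phi>_def] Y]
    by (simp add: mat_minus_mult mat_trace_minus less_eq_complex_def)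
  also have "mat_trace ((1\<^sub>m p \<Otimes> X) * (Y * mat_adjoint Y)) = mat_trace (X * ptrace_first p r (Y * mat_adjoint Y))"
    by (rule mat_trace_one_tensor_mult) simp_all
  also have "Re \<dots> \<le> Re (mat_trace X)"
    using feasible by (simp add: mat_mult_minus mat_trace_minus less_eq_complex_def)
  finally show ?thesis .
qed

lemma mat_trace_one_tensor:
  assumes "dim_row X = dim_col X"
  shows "mat_trace (1\<^sub>m p \<Otimes> X) = of_nat p * mat_trace X"
  using assms by (simp add: mat_trace_def sum_lessThan_mult index_one_tensor)

lemma psd_one_tensor_imp_psd:
  assumes "psd (p * r) (1\<^sub>m p \<Otimes> X)" "dim_row X = r" "dim_col X = r" "0 < p"
  shows "psd r X"
proof -
  have "ptrace_first p r (1\<^sub>m p \<Otimes> X) = of_nat p \<cdot>\<^sub>m X"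
    using assms by (intro eq_matI) (simp_all add: ptrace_first_def index_one_tensor)
  then have "psd r (of_real (1 / real p) \<cdot>\<^sub>m (of_nat p \<cdot>\<^sub>m X))"
    using psd_ptrace_first[OF assms(1)] by (intro psd_smult) simp_all
  moreover have "of_real (1 / real p) \<cdot>\<^sub>m (of_nat p \<cdot>\<^sub>m X) = X"
    using assms(4) by (intro eq_matI) simp_all
  ultimately show ?thesis by simp
qed

lemma mat_trace_reshuffle_gram:
  assumes "M \<in> carrier_mat (p * q) r"
  shows "mat_trace (reshuffle p q r M * mat_adjoint (reshuffle p q r M)) = mat_trace (M * mat_adjoint M)"
proof -
  let ?f = "\<lambda>a b c. complex_of_real ((cmod (M $$ (a * q + b, c)))\<^sup>2)"
  have [simp]: "dim_row M = p * q" "dim_col M = r" using assms by simp_all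
  have "mat_trace (reshuffle p q r M * mat_adjoint (reshuffle p q r M)) =
      mat_trace (mat_adjoint (reshuffle p q r M) * reshuffle p q r M)"
    by (rule mat_trace_comm) simp_all
  also have "\<dots> = (\<Sum>a<p. \<Sum>c<r. \<Sum>b<q. ?f a b c)"
    by (simp add: mat_trace_mult_adjoint sum_lessThan_mult reshuffle_def)
  also have "\<dots> = (\<Sum>a<p. \<Sum>b<q. \<Sum>c<r. ?f a b c)"
    by (rule sum.cong[OF refl], rule sum.swap)
  also have "\<dots> = mat_trace (mat_adjoint M * M)"
    by (simp add: mat_trace_mult_adjoint sum_lessThan_mult)
  also have "\<dots> = mat_trace (M * mat_adjoint M)"
    by (rule mat_trace_comm) simp_all
  finally show ?thesis .
qed

text \<open>Strong half: the state is read off the dual optimum E = Y Y*. The matrix M = \<Phi>* Y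
  has squared norm tr X = s^2; taking for \<open>K\<close> its conjugate divided by \<open>s\<close>
  makes Cauchy-Schwarz an equality, and K K* is the state.\<close>

lemma fidelity_strong_bound:
  assumes Psi: "\<Psi> \<in> carrier_mat (p * q) r" and tr1: "mat_trace (\<Psi> * mat_adjoint \<Psi>) = 1"
  obtains \<sigma> X where "density q \<sigma>" "psd r X" "0 < Re (mat_trace X)"
    "psd (p * r) ((1\<^sub>m p \<Otimes> X) - reshuffle p q r \<Psi> * mat_adjoint (reshuffle p q r \<Psi>))"
    "\<And>R. psd (p * q) R \<Longrightarrow>
      R * R = (1\<^sub>m p \<Otimes> psd_sqrt \<sigma>) * (\<Psi> * mat_adjoint \<Psi>) * (1\<^sub>m p \<Otimes> psd_sqrt \<sigma>) \<Longrightarrow>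
      Re (mat_trace X) \<le> (Re (mat_trace R))\<^sup>2"
proof -
  define \<Phi> where "\<Phi> = reshuffle p q r \<Psi>"
  have [simp]: "dim_row \<Psi> = p * q" "dim_col \<Psi> = r" "dim_row \<Phi> = p * r" "dim_col \<Phi> = q"
    using Psi by (simp_all add: \<Phi>_def)
  have Phi: "\<Phi> \<in> carrier_mat (p * r) q" by (simp add: \<Phi>_def)
  have psdPhi: "psd (p * r) (\<Phi> * mat_adjoint \<Phi>)" by (rule psd_gram[OF Phi])
  obtain E X where E: "psd (p * r) E" "psd r (1\<^sub>m r - ptrace_first p r E)"
    and X: "X \<in> carrier_mat r r" "psd (p * r) ((1\<^sub>m p \<Otimes> X) - \<Phi> * mat_adjoint \<Phi>)"
    and trX: "mat_trace X = mat_trace (\<Phi> * mat_adjoint \<Phi> * E)"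
    using strong_duality[OF psdPhi] .
  have [simp]: "dim_row X = r" "dim_col X = r" using X by simp_all
  have pX: "psd (p * r) (1\<^sub>m p \<Otimes> X)"
  proof -
    have "(1\<^sub>m p \<Otimes> X) - \<Phi> * mat_adjoint \<Phi> + \<Phi> * mat_adjoint \<Phi> = 1\<^sub>m p \<Otimes> X"
      by (rule eq_matI) (simp_all del: index_mult_mat(1))
    then show ?thesis using psd_add[OF X(2) psdPhi] by simp
  qed
  have "0 \<le> mat_trace ((1\<^sub>m p \<Otimes> X) - \<Phi> * mat_adjoint \<Phi>)" by (rule psd_trace_nonneg[OF X(2)])
  also have "\<dots> = of_nat p * mat_trace X - 1"
    using mat_trace_reshuffle_gram[OF Psi] tr1
    by (simp add: mat_trace_minus mat_trace_one_tensor \<Phi>_def)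
  \<comment> \<open>The trace of \<Phi> \<Phi>* \<le> 1 \<otimes> X excludes p = 0 and makes tr X
    positive, so that \<open>s\<close> can be a divisor.\<close>
  finally have ptr: "1 \<le> real p * Re (mat_trace X)" by (simp add: less_eq_complex_def)
  then have p: "0 < p" by (cases p) auto
  have pos: "0 < Re (mat_trace X)" using ptr p by (smt (verit) mult_nonneg_nonpos of_nat_0_le_iff)
  have psdX: "psd r X" using psd_one_tensor_imp_psd[OF pX _ _ p] by simp
  have reX: "mat_trace X = of_real (Re (mat_trace X))"
    using psd_trace_nonneg[OF psdX] by (simp add: less_eq_complex_def complex_eq_iff)
  define s where "s = sqrt (Re (mat_trace X))"
  have s: "0 < s" "s * s = Re (mat_trace X)" using pos by (simp_all add: s_def)
  define Y where "Y = psd_sqrt E"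
  have Y: "psd (p * r) Y" "Y * Y = E"
    using psd_psd_sqrt[OF E(1)] psd_sqrt_mult_self[OF E(1)] by (simp_all add: Y_def)
  have [simp]: "dim_row Y = p * r" "dim_col Y = p * r" using Y by (simp_all add: psd_dim)
  have YY: "Y * mat_adjoint Y = E" using Y by (simp add: psd_hermitian)
  define M where "M = mat_adjoint \<Phi> * Y"
  have [simp]: "dim_row M = q" "dim_col M = p * r" by (simp_all add: M_def)
  have MM: "mat_trace (mat_adjoint M * M) = of_real (s * s)"
  proof -
    have "mat_trace (mat_adjoint M * M) = mat_trace (\<Phi> * mat_adjoint \<Phi> * (Y * mat_adjoint Y))"
      using mat_trace_comm[of "mat_adjoint Y" "\<Phi> * (mat_adjoint \<Phi> * Y)"]
      by (simp add: M_def mat_adjoint_mult mat_mult_assoc)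
    then show ?thesis unfolding YY s(2) using trX reX by simp
  qed
  define K where "K = of_real (1 / s) \<cdot>\<^sub>m map_mat cnj M"
  have [simp]: "dim_row K = q" "dim_col K = p * r" by (simp_all add: K_def)
  have K: "K \<in> carrier_mat q (p * r)" by (rule carrier_matI) simp_all
  define \<sigma> where "\<sigma> = K * mat_adjoint K"
  have [simp]: "dim_row \<sigma> = q" "dim_col \<sigma> = q" by (simp_all add: \<sigma>_def)
  have KT: "transpose_mat K = of_real (1 / s) \<cdot>\<^sub>m mat_adjoint M"
    unfolding K_def by (rule eq_matI) simp_all
  have sigma: "density q \<sigma>"
  proof -
    have "mat_trace \<sigma> = mat_trace (mat_adjoint K * K)"
      unfolding \<sigma>_def by (rule mat_trace_comm) simp_all
    also have "\<dots> = of_real (1 / s) * of_real (1 / s) * mat_trace (mat_adjoint (map_mat cnj M) * map_mat cnj M)"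
      by (simp add: K_def mat_ring_simps mat_trace_smult del: mat_adjoint_map_cnj)
    also have "\<dots> = 1" unfolding mat_trace_adjoint_mult_map_cnj MM using s(1) by simp
    finally show ?thesis unfolding density_def using psd_gram[OF K] by (simp add: \<sigma>_def)
  qed
  define C where "C = psd_sqrt \<sigma>"
  have C: "psd q C" "C * C = \<sigma>"
    using sigma psd_psd_sqrt[of q \<sigma>] psd_sqrt_mult_self[of q \<sigma>] by (simp_all add: C_def density_def)
  have [simp]: "dim_row C = q" "dim_col C = q" using C by (simp_all add: psd_dim)
  define S where "S = 1\<^sub>m p \<Otimes> C"
  have [simp]: "dim_row S = p * q" "dim_col S = p * q" by (simp_all add: S_def)
  have SH: "mat_adjoint S = S" by (simp add: S_def one_tensor_adjoint psd_hermitian[OF C(1)])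
  have SS: "S * S = 1\<^sub>m p \<Otimes> \<sigma>" by (simp add: S_def one_tensor_mult C)
  \<comment> \<open>\<open>K\<close> need be neither square nor the positive root \<open>C\<close>
    of \<open>\<sigma>\<close>, but \<open>B\<close> depends on K K* = C C only; hence B = T* T with
    \<open>T\<close> built from \<open>C\<close>.\<close>
  define B where "B = mat_adjoint \<Psi> * (1\<^sub>m p \<Otimes> \<sigma>) * \<Psi>"
  define T where "T = S * \<Psi>"
  have T: "T \<in> carrier_mat (p * q) r" by (rule carrier_matI) (simp_all add: T_def)
  have [simp]: "dim_row T = p * q" "dim_col T = r" using T by simp_all
  have TT: "B = mat_adjoint T * T"
    by (simp add: B_def T_def mat_adjoint_mult SH SS[symmetric] mat_mult_assoc)
  have "psd r B" using psd_gram[of "mat_adjoint T" r "p * q"] T by (simp add: TT)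
  then have Q: "psd r (psd_sqrt B)" "psd_sqrt B * psd_sqrt B = B"
    by (simp_all add: psd_psd_sqrt psd_sqrt_mult_self)
  have le1: "s \<le> Re (mat_trace (psd_sqrt B))"
  proof -
    \<comment> \<open>Feasibility of \<open>E\<close> makes \<open>?W\<close> a contraction, and
      \<open>?A\<close> times its adjoint is \<open>B\<close>. The pairing of the two has value
      \<open>s\<close>, a lower bound for the trace norm of \<open>?A\<close>.\<close>
    let ?A = "mat_adjoint \<Psi> * (1\<^sub>m p \<Otimes> K)" and ?W = "reshuffle p r (p * r) Y"
    have "mat_trace (?A * ?W) = mat_trace (transpose_mat K * M)"
      unfolding M_def \<Phi>_def by (rule mat_trace_reshuffle[OF Psi K psd_carrier[OF Y(1)]])
    also have "\<dots> = of_real s" using s(1) by (simp add: KT mat_smult_mult mat_trace_smult MM)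
    finally have "s = Re (mat_trace (?A * ?W))" by simp
    also have "\<dots> \<le> Re (mat_trace (psd_sqrt B))"
    proof (rule trace_mult_contraction_le[OF _ Q(1) _ reshuffle_carrier])
      show "?A \<in> carrier_mat r (p * (p * r))" by (rule carrier_matI) simp_all
      show "psd_sqrt B * psd_sqrt B = ?A * mat_adjoint ?A"
        unfolding Q(2) unfolding B_def \<sigma>_def
        by (simp add: mat_adjoint_mult one_tensor_adjoint one_tensor_mult[symmetric] mat_mult_assoc)
      show "psd r (1\<^sub>m r - mat_adjoint ?W * ?W)"
        unfolding reshuffle_gram[OF psd_carrier[OF Y(1)]] YY using E(2)
        by (simp add: psd_one_minus_transpose_iff)
    qed
    finally show ?thesis .
  qed
  show thesis
  proof (rule that[OF sigma psdX pos])
    show "psd (p * r) ((1\<^sub>m p \<Otimes> X) - reshuffle p q r \<Psi> * mat_adjoint (reshuffle p q r \<Psi>))"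
      using X(2) by (simp add: \<Phi>_def)
    fix R assume R: "psd (p * q) R"
      "R * R = (1\<^sub>m p \<Otimes> psd_sqrt \<sigma>) * (\<Psi> * mat_adjoint \<Psi>) * (1\<^sub>m p \<Otimes> psd_sqrt \<sigma>)"
    \<comment> \<open>\<open>R\<close> is the root of T T*, whereas \<open>psd_sqrt B\<close> is the
      root of T* T. The polar contraction of \<open>T\<close> transfers the lower bound from one to
      the other.\<close>
    obtain W where W: "W \<in> carrier_mat r (p * q)" "psd (p * q) (1\<^sub>m (p * q) - mat_adjoint W * W)"
      "mat_trace (W * T) = mat_trace (psd_sqrt B)"
      using polar_trace[OF T Q(1)] Q(2) TT by metis
    have "Re (mat_trace (T * W)) \<le> Re (mat_trace R)"
    proof (rule trace_mult_contraction_le[OF T R(1) _ W(1,2)])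
      show "R * R = T * mat_adjoint T"
        unfolding R(2) C_def[symmetric] S_def[symmetric]
        by (simp add: T_def mat_adjoint_mult SH mat_mult_assoc)
    qed
    moreover have "mat_trace (T * W) = mat_trace (W * T)"
      using W(1) by (intro mat_trace_comm) simp_all
    ultimately have "s \<le> Re (mat_trace R)" using W(3) le1 by simp
    then have "s * s \<le> Re (mat_trace R) * Re (mat_trace R)"
      using s(1) by (intro mult_mono) simp_all
    then show "Re (mat_trace X) \<le> (Re (mat_trace R))\<^sup>2" by (simp add: s(2) power2_eq_square)
  qed
qed

text \<open>The root of \<open>mixed_state p \<Otimes> \<sigma>\<close> is
  \<open>1 \<otimes> psd_sqrt \<sigma>\<close> divided by \<open>sqrt p\<close>, so the fidelity is
  the trace of \<open>R\<close> divided by \<open>sqrt p\<close>, and the factor \<open>p\<close>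
  cancels the scaling.\<close>

lemma fidelity_mixed_state_tensor:
  assumes rho: "psd (p * q) \<rho>" and sigma: "psd q \<sigma>" and p: "0 < p"
  obtains R where "psd (p * q) R"
    "R * R = (1\<^sub>m p \<Otimes> psd_sqrt \<sigma>) * \<rho> * (1\<^sub>m p \<Otimes> psd_sqrt \<sigma>)"
    "real p * (fidelity \<rho> (mixed_state p \<Otimes> \<sigma>))\<^sup>2 = (Re (mat_trace R))\<^sup>2"
proof -
  define K where "K = psd_sqrt \<sigma>"
  have K: "psd q K" "K * K = \<sigma>" using sigma by (simp_all add: K_def psd_psd_sqrt psd_sqrt_mult_self)
  define C where "C = psd_sqrt \<rho>"
  have C: "psd (p * q) C" "C * C = \<rho>" using rho by (simp_all add: C_def psd_psd_sqrt psd_sqrt_mult_self)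
  define S where "S = 1\<^sub>m p \<Otimes> K"
  define c where "c = 1 / sqrt (real p)"
  have c: "0 < c" "c * c = 1 / real p" using p by (simp_all add: c_def)
  have [simp]: "dim_row K = q" "dim_col K = q" "dim_row C = p * q" "dim_col C = p * q"
    "dim_row S = p * q" "dim_col S = p * q"
    using K C by (simp_all add: psd_dim S_def)
  have S: "psd (p * q) S" unfolding S_def by (rule psd_one_tensor[OF K(1)])
  have "psd_sqrt (mixed_state p \<Otimes> \<sigma>) = of_real c \<cdot>\<^sub>m S"
  proof (rule psd_sqrt_eqI)
    show "psd (p * q) (of_real c \<cdot>\<^sub>m S)" using S c by (intro psd_smult) simp_all
    have "(of_real c \<cdot>\<^sub>m S) * (of_real c \<cdot>\<^sub>m S) = of_real (c * c) \<cdot>\<^sub>m (1\<^sub>m p \<Otimes> \<sigma>)"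
      by (simp add: mat_ring_simps S_def one_tensor_mult K)
    then show "(of_real c \<cdot>\<^sub>m S) * (of_real c \<cdot>\<^sub>m S) = mixed_state p \<Otimes> \<sigma>"
      by (simp add: c mixed_state_def smult_one_tensor)
  qed
  then have fid: "fidelity \<rho> (mixed_state p \<Otimes> \<sigma>) = trace_norm (C * (of_real c \<cdot>\<^sub>m S))"
    by (simp add: fidelity_def C_def)
  define A where "A = S * \<rho> * S"
  have "psd (p * q) (S * \<rho> * mat_adjoint S)" by (rule psd_congruence[OF rho psd_carrier[OF S]])
  then have A: "psd (p * q) A" by (simp add: A_def psd_hermitian[OF S])
  define R where "R = psd_sqrt A"
  have R: "psd (p * q) R" "R * R = A" using A by (simp_all add: R_def psd_psd_sqrt psd_sqrt_mult_self)
  have [simp]: "dim_row R = p * q" "dim_col R = p * q" using R by (simp_all add: psd_dim)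
  have "psd_sqrt (mat_adjoint (C * (of_real c \<cdot>\<^sub>m S)) * (C * (of_real c \<cdot>\<^sub>m S))) = of_real c \<cdot>\<^sub>m R"
  proof (rule psd_sqrt_eqI)
    show "psd (p * q) (of_real c \<cdot>\<^sub>m R)" using R c by (intro psd_smult) simp_all
    show "(of_real c \<cdot>\<^sub>m R) * (of_real c \<cdot>\<^sub>m R) =
        mat_adjoint (C * (of_real c \<cdot>\<^sub>m S)) * (C * (of_real c \<cdot>\<^sub>m S))"
      by (simp add: mat_adjoint_mult mat_ring_simps psd_hermitian[OF S] psd_hermitian[OF C(1)] R(2) A_def
          C(2)[symmetric])
  qed
  then have "trace_norm (C * (of_real c \<cdot>\<^sub>m S)) = c * Re (mat_trace R)"
    unfolding trace_norm_def by (simp add: mat_trace_smult)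
  then have "real p * (fidelity \<rho> (mixed_state p \<Otimes> \<sigma>))\<^sup>2 = real p * (c * c) * (Re (mat_trace R))\<^sup>2"
    unfolding fid by (simp add: power2_eq_square)
  also have "\<dots> = (Re (mat_trace R))\<^sup>2" using c p by simp
  finally show thesis using that[OF R(1)] R(2) by (simp add: A_def S_def K_def)
qed

text \<open>A state \<sigma> with exponent l corresponds to Z = 2^l \<sigma>, whose trace is 2^l.
  Minimizing over both is minimizing tr Z subject to \<tau> \<le> 1 \<otimes> Z, and normalizing the
  minimizer \<open>X\<close> gives the optimal state.\<close>

lemma INF_D_inf_eq:
  assumes X: "psd r X" "0 < Re (mat_trace X)" "psd (p * r) ((1\<^sub>m p \<Otimes> X) - \<tau>)"
    and min: "\<And>Z. psd r Z \<Longrightarrow> psd (p * r) ((1\<^sub>m p \<Otimes> Z) - \<tau>) \<Longrightarrow> Re (mat_trace X) \<le> Re (mat_trace Z)"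
  shows "(INF \<sigma>\<in>{\<sigma>. density r \<sigma>}. D_inf (p * r) \<tau> (1\<^sub>m p \<Otimes> \<sigma>)) = ereal (log 2 (Re (mat_trace X)))"
proof (rule antisym)
  define x where "x = Re (mat_trace X)"
  have x: "0 < x" using X by (simp add: x_def)
  have trX: "mat_trace X = of_real x"
    using psd_trace_nonneg[OF X(1)] by (simp add: x_def less_eq_complex_def complex_eq_iff)
  have [simp]: "dim_row X = r" "dim_col X = r" using X by (simp_all add: psd_dim)
  define \<sigma> where "\<sigma> = of_real (1 / x) \<cdot>\<^sub>m X"
  have sigma: "density r \<sigma>"
    unfolding density_def \<sigma>_def using x psd_smult[OF X(1), of "1 / x"]
    by (simp add: mat_trace_smult trX)
  have "of_real (2 powr log 2 x) \<cdot>\<^sub>m (1\<^sub>m p \<Otimes> \<sigma>) = 1\<^sub>m p \<Otimes> X"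
    using x by (intro eq_matI) (simp_all add: \<sigma>_def one_tensor_smult)
  then have "D_inf (p * r) \<tau> (1\<^sub>m p \<Otimes> \<sigma>) \<le> ereal (log 2 x)"
    unfolding D_inf_def using X(3) by (intro Inf_lower) auto
  then show "(INF \<sigma>\<in>{\<sigma>. density r \<sigma>}. D_inf (p * r) \<tau> (1\<^sub>m p \<Otimes> \<sigma>)) \<le> ereal (log 2 (Re (mat_trace X)))"
    using sigma by (intro INF_lower2[of \<sigma>]) (simp_all add: x_def)
  show "ereal (log 2 (Re (mat_trace X))) \<le> (INF \<sigma>\<in>{\<sigma>. density r \<sigma>}. D_inf (p * r) \<tau> (1\<^sub>m p \<Otimes> \<sigma>))"
  proof (rule INF_greatest)
    fix \<sigma> assume "\<sigma> \<in> {\<sigma>. density r \<sigma>}"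
    then have s: "psd r \<sigma>" "mat_trace \<sigma> = 1" by (simp_all add: density_def)
    show "ereal (log 2 (Re (mat_trace X))) \<le> D_inf (p * r) \<tau> (1\<^sub>m p \<Otimes> \<sigma>)"
      unfolding D_inf_def
    proof (rule Inf_greatest)
      fix e assume "e \<in> {ereal l |l. psd (p * r) (complex_of_real (2 powr l) \<cdot>\<^sub>m (1\<^sub>m p \<Otimes> \<sigma>) - \<tau>)}"
      then obtain l where e: "e = ereal l"
        and l: "psd (p * r) (of_real (2 powr l) \<cdot>\<^sub>m (1\<^sub>m p \<Otimes> \<sigma>) - \<tau>)" by blast
      have "Re (mat_trace X) \<le> Re (mat_trace (of_real (2 powr l) \<cdot>\<^sub>m \<sigma>))"
        using s l by (intro min psd_smult) (simp_all add: one_tensor_smult)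
      also have "\<dots> = 2 powr l" using s by (simp add: mat_trace_smult psd_dim)
      finally show "ereal (log 2 (Re (mat_trace X))) \<le> e"
        using X(2) by (simp add: e log_le_iff)
    qed
  qed
qed

lemma purificationE:
  assumes "purification n r \<rho> \<omega>"
  obtains \<psi> where "\<psi> \<in> carrier_mat (n * r) 1" "\<omega> = \<psi> * mat_adjoint \<psi>"
    "\<rho> = amplitudes n r \<psi> * mat_adjoint (amplitudes n r \<psi>)"
proof -
  from assms have *: "density (n * r) \<omega>" "vec_space.rank (n * r) \<omega> = 1" "ptrace_last n r \<omega> = \<rho>"
    by (simp_all add: purification_def)
  obtain \<psi> where "\<psi> \<in> carrier_mat (n * r) 1" "\<omega> = \<psi> * mat_adjoint \<psi>"
    using rank_one_density_gram[OF *(1,2)] .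
  then show thesis using that ptrace_last_gram *(3) by metis
qed

text \<open>The right-hand side involves neither \<open>dC\<close> nor \<open>\<omega>\<close>: the
  value is the same for every purification, as the definite description in \<open>H_max\<close>
  requires.\<close>

lemma H_min_purification:
  assumes rho: "density (dA * dB) \<rho>" and pur: "purification (dA * dB) dC \<rho> \<omega>"
  shows "H_min dA dC (ptrace_middle dA dB dC \<omega>) = - ereal (log 2 (q_decpl dA dB \<rho>))"
proof -
  have psd_rho: "psd (dA * dB) \<rho>" and tr: "mat_trace \<rho> = 1" using rho by (simp_all add: density_def)
  have dA: "0 < dA"
    using tr psd_dim[OF psd_rho] by (cases dA) (auto simp: mat_trace_def)
  obtain \<psi> where psi: "\<psi> \<in> carrier_mat (dA * dB * dC) 1" and \<omega>: "\<omega> = \<psi> * mat_adjoint \<psi>"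
    and \<rho>: "\<rho> = amplitudes (dA * dB) dC \<psi> * mat_adjoint (amplitudes (dA * dB) dC \<psi>)"
    using purificationE[OF pur] .
  define \<Psi> where "\<Psi> = amplitudes (dA * dB) dC \<psi>"
  have Psi: "\<Psi> \<in> carrier_mat (dA * dB) dC" by (simp add: \<Psi>_def)
  have \<rho>: "\<rho> = \<Psi> * mat_adjoint \<Psi>" using \<rho> by (simp add: \<Psi>_def)
  define \<tau> where "\<tau> = reshuffle dA dB dC \<Psi> * mat_adjoint (reshuffle dA dB dC \<Psi>)"
  have \<tau>: "ptrace_middle dA dB dC \<omega> = \<tau>"
    unfolding \<omega> \<tau>_def \<Psi>_def by (rule ptrace_middle_gram[OF psi])
  obtain \<sigma> X where sigma: "density dB \<sigma>" and X: "psd dC X" "0 < Re (mat_trace X)"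
    "psd (dA * dC) ((1\<^sub>m dA \<Otimes> X) - \<tau>)"
    and strong: "\<And>R. psd (dA * dB) R \<Longrightarrow>
      R * R = (1\<^sub>m dA \<Otimes> psd_sqrt \<sigma>) * \<rho> * (1\<^sub>m dA \<Otimes> psd_sqrt \<sigma>) \<Longrightarrow>
      Re (mat_trace X) \<le> (Re (mat_trace R))\<^sup>2"
    using fidelity_strong_bound[OF Psi tr[unfolded \<rho>]] unfolding \<tau>_def \<rho> by metis
  let ?F = "\<lambda>\<sigma>. (fidelity \<rho> (mixed_state dA \<Otimes> \<sigma>))\<^sup>2"
  have weak: "real dA * ?F \<sigma>' \<le> Re (mat_trace Z)"
    if "density dB \<sigma>'" "psd dC Z" "psd (dA * dC) ((1\<^sub>m dA \<Otimes> Z) - \<tau>)" for \<sigma>' Z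
  proof -
    have "psd dB \<sigma>'" using that(1) by (simp add: density_def)
    then obtain R where "psd (dA * dB) R"
      "R * R = (1\<^sub>m dA \<Otimes> psd_sqrt \<sigma>') * \<rho> * (1\<^sub>m dA \<Otimes> psd_sqrt \<sigma>')"
      "real dA * ?F \<sigma>' = (Re (mat_trace R))\<^sup>2"
      using fidelity_mixed_state_tensor[OF psd_rho _ dA] by metis
    then show ?thesis
      using fidelity_weak_bound[OF Psi that(1,2) that(3)[unfolded \<tau>_def], of R] \<rho> by simp
  qed
  have "Re (mat_trace X) \<le> real dA * ?F \<sigma>"
  proof -
    have "psd dB \<sigma>" using sigma by (simp add: density_def)
    then obtain R where "psd (dA * dB) R"
      "R * R = (1\<^sub>m dA \<Otimes> psd_sqrt \<sigma>) * \<rho> * (1\<^sub>m dA \<Otimes> psd_sqrt \<sigma>)"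
      "real dA * ?F \<sigma> = (Re (mat_trace R))\<^sup>2"
      using fidelity_mixed_state_tensor[OF psd_rho _ dA] by metis
    then show ?thesis using strong by simp
  qed
  \<comment> \<open>Weak and strong bounds meet at \<open>\<sigma>\<close> and \<open>X\<close>;
    this equality certifies both as optimal. With \<open>X\<close> fixed and the state varying, the
    weak bound gives the maximum.\<close>
  then have opt: "real dA * ?F \<sigma> = Re (mat_trace X)" using weak[OF sigma X(1,3)] by simp
  have "(GREATEST x. \<exists>\<sigma>. density dB \<sigma> \<and> x = ?F \<sigma>) = ?F \<sigma>"
  proof (rule Greatest_equality)
    fix y assume "\<exists>\<sigma>. density dB \<sigma> \<and> y = ?F \<sigma>"
    then have "real dA * y \<le> real dA * ?F \<sigma>" using weak[OF _ X(1,3)] opt by auto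
    then show "y \<le> ?F \<sigma>" using dA by simp
  qed (use sigma in blast)
  then have q: "q_decpl dA dB \<rho> = Re (mat_trace X)" by (simp add: q_decpl_def opt)
  \<comment> \<open>With \<open>\<sigma>\<close> fixed and \<open>Z\<close> varying, the weak bound
    shows that \<open>X\<close> is the primal minimizer.\<close>
  have "Re (mat_trace X) \<le> Re (mat_trace Z)"
    if "psd dC Z" "psd (dA * dC) ((1\<^sub>m dA \<Otimes> Z) - \<tau>)" for Z
    using weak[OF sigma that] opt by simp
  then show ?thesis unfolding \<tau> H_min_def q by (simp only: INF_D_inf_eq[OF X])
qed

theorem theorem3:
  fixes dA dB :: nat and \<rho> :: "complex mat"
  assumes "density (dA * dB) \<rho>"
  shows "H_max dA dB \<rho> = ereal (log 2 (q_decpl dA dB \<rho>))"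
  unfolding H_max_def
proof (rule the_equality)
  \<comment> \<open>A purification exists, so the description is not vacuous; uniqueness is the
    independence given by \<open>H_min_purification\<close>.\<close>
  obtain dC \<omega> where pur: "purification (dA * dB) dC \<rho> \<omega>" using exists_purification[OF assms] by blast
  then have "ereal (log 2 (q_decpl dA dB \<rho>)) = - H_min dA dC (ptrace_middle dA dB dC \<omega>)"
    using H_min_purification[OF assms pur] by simp
  then show "\<exists>dC \<omega>. purification (dA * dB) dC \<rho> \<omega> \<and>
      ereal (log 2 (q_decpl dA dB \<rho>)) = - H_min dA dC (ptrace_middle dA dB dC \<omega>)"
    using pur by blast
qed (use H_min_purification[OF assms] in auto)

end
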